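(* Let $\mathcal{W}$ be a closed subspace of $\mathcal{H}$. Then $\mathcal{W}$ is the wandering subspace of an invariant subspace $\mathcal{M}$ of $B$ (that is, $\mathcal{W}=\mathcal{M}\ominus B\mathcal{M}$ for some invariant subspace $\mathcal{M}$ of $B$) if and only if for every function $q(z,w)$ in $\mathcal{W}$ there is a constant $c_q$ such that $$\sum_{j=0}^{\infty}\left|T_{w}^{*j}q(0,w)\right|^{2}=c_q\qquad\text{for all } w\in\partial\mathbb{D}.$$
   Context: $\mathbb{D}$ is the open unit disc, $\mathbb{T}=\partial\mathbb{D}$ the unit circle. $H^2(\mathbb{T})$ is the Hardy space of the circle and $H^2(\mathbb{T}^2)=H^2(\mathbb{T})\otimes H^2(\mathbb{T})$ is the Hardy space of the bidisc, with variables $z,w$. Let $p_n(z,w)=\sum_{i=0}^{n}z^iw^{n-i}$ for $n\ge 0$, and let $\mathcal{H}$ be the closed linear span of $\{p_n\}_{n\ge0}$ in $H^2(\mathbb{T}^2)$; equivalently $\mathcal{H}=H^2(\mathbb{T}^2)\ominus[z-w]$, where $[z-w]$ is the closure of $(z-w)H^2(\mathbb{T}^2)$. Let $T_z,T_w$ be multiplication by $z$, $w$ on $H^2(\mathbb{T}^2)$, and let $P_{\mathcal{H}}$ be the orthogonal projection onto $\mathcal{H}$. The operator $B=P_{\mathcal{H}}T_z|_{\mathcal{H}}=P_{\mathcal{H}}T_w|_{\mathcal{H}}$ on $\mathcal{H}$ is unitarily equivalent to the Bergman shift (multiplication by the coordinate function on the Bergman space $L^2_a(\mathbb{D})$) and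 is called the Bergman shift here. An invariant subspace of $B$ is a closed subspace $\mathcal{M}\subseteq\mathcal{H}$ with $B\mathcal{M}\subseteq\mathcal{M}$; its wandering subspace is $\mathcal{M}\ominus B\mathcal{M}=\mathcal{M}\cap(B\mathcal{M})^{\perp}$. For $q\in\mathcal{H}$, $q(0,w)$ denotes the function in $H^2(\mathbb{T})$ obtained by setting $z=0$, and $T_w^{*j}q(0,w)$ denotes the result of applying $T_w^{*j}$ to the function $q(0,\cdot)$, where on $H^2(\mathbb{T})$ the operator $T_w^*$ is the backward shift $\sum_{k\ge0}a_kw^k\mapsto\sum_{k\ge0}a_{k+1}w^k$. Functions on $\partial\mathbb{D}$ are boundary values, and identities between them are understood almost everywhere on $\partial\mathbb{D}$. *)

theory Defs
  imports "HOL-Probability.Probability"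
begin

text \<open>
  Elements of \<open>L\<^sup>2\<close> are represented by Borel functions, not by classes modulo null sets. Subspaces
  that are closed in the sense below contain, with each function, every Borel function equal to it
  almost everywhere, so they correspond exactly to closed subspaces of the usual quotient.
\<close>

definition L2 :: "'a measure \<Rightarrow> ('a \<Rightarrow> complex) set" where
  "L2 M = {f. f \<in> borel_measurable M \<and> integrable M (\<lambda>x. (cmod (f x))\<^sup>2)}"

definition L2_inner :: "'a measure \<Rightarrow> ('a \<Rightarrow> complex) \<Rightarrow> ('a \<Rightarrow> complex) \<Rightarrow> complex" where
  "L2_inner M f g = (LINT x|M. f x * cnj (g x))"

definition L2_norm :: "'a measure \<Rightarrow> ('a \<Rightarrow> complex) \<Rightarrow> real" where
  "L2_norm M f = sqrt (LINT x|M. (cmod (f x))\<^sup>2)"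

definition closed_subspace :: "'a measure \<Rightarrow> ('a \<Rightarrow> complex) set \<Rightarrow> bool" where
  "closed_subspace M S \<longleftrightarrow>
     S \<subseteq> L2 M \<and> (\<lambda>x. 0) \<in> S \<and>
     (\<forall>f\<in>S. \<forall>g\<in>S. (\<lambda>x. f x + g x) \<in> S) \<and>
     (\<forall>c. \<forall>f\<in>S. (\<lambda>x. c * f x) \<in> S) \<and>
     (\<forall>u f. (\<forall>n::nat. u n \<in> S) \<and> f \<in> L2 M \<and>
        (\<lambda>n. L2_norm M (\<lambda>x. u n x - f x)) \<longlonglongrightarrow> 0 \<longrightarrow> f \<in> S)"

text \<open>
  For a closed subspace \<open>S\<close> and \<open>f\<close> in \<open>L\<^sup>2\<close>, the projection exists and is determined up to a null
  set; the choice operator only picks a representative.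
\<close>

definition orth_proj :: "'a measure \<Rightarrow> ('a \<Rightarrow> complex) set \<Rightarrow> ('a \<Rightarrow> complex) \<Rightarrow> ('a \<Rightarrow> complex)" where
  "orth_proj M S f = (SOME g. g \<in> S \<and> (\<forall>h\<in>S. L2_inner M (\<lambda>x. f x - g x) h = 0))"

text \<open>
  Normalised arc length on the unit circle, as a measure on the plane concentrated on the circle
  (so values of functions off the circle are irrelevant).
\<close>

definition circle :: "complex measure" where
  "circle = distr (uniform_measure lborel {0..2 * pi}) borel cis"

definition torus :: "(complex \<times> complex) measure" where
  "torus = circle \<Otimes>\<^sub>M circle"

definition fourier_circle :: "(complex \<Rightarrow> complex) \<Rightarrow> int \<Rightarrow> complex" where
  "fourier_circle f n = L2_inner circle f (\<lambda>w. w powi n)"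

definition fourier_torus :: "(complex \<times> complex \<Rightarrow> complex) \<Rightarrow> int \<Rightarrow> int \<Rightarrow> complex" where
  "fourier_torus f m n = L2_inner torus f (\<lambda>(z, w). z powi m * w powi n)"

definition hardy_torus :: "(complex \<times> complex \<Rightarrow> complex) set" where
  "hardy_torus = {f \<in> L2 torus. \<forall>m n. m < 0 \<or> n < 0 \<longrightarrow> fourier_torus f m n = 0}"

definition diag_poly :: "nat \<Rightarrow> complex \<times> complex \<Rightarrow> complex" where
  "diag_poly n = (\<lambda>(z, w). \<Sum>i\<le>n. z ^ i * w ^ (n - i))"

definition diag_space :: "(complex \<times> complex \<Rightarrow> complex) set" where
  "diag_space = {f \<in> hardy_torus. \<forall>e>0. \<exists>N (a :: nat \<Rightarrow> complex).
     L2_norm torus (\<lambda>x. f x - (\<Sum>n<N. a n * diag_poly n x)) < e}"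

definition bergman_shift :: "(complex \<times> complex \<Rightarrow> complex) \<Rightarrow> (complex \<times> complex \<Rightarrow> complex)" where
  "bergman_shift f = orth_proj torus diag_space (\<lambda>(z, w). z * f (z, w))"

definition invariant_subspace :: "(complex \<times> complex \<Rightarrow> complex) set \<Rightarrow> bool" where
  "invariant_subspace M \<longleftrightarrow>
     closed_subspace torus M \<and> M \<subseteq> diag_space \<and> bergman_shift ` M \<subseteq> M"

definition wandering_subspace ::
    "(complex \<times> complex \<Rightarrow> complex) set \<Rightarrow> (complex \<times> complex \<Rightarrow> complex) set" where
  "wandering_subspace M = {f \<in> M. \<forall>g \<in> bergman_shift ` M. L2_inner torus f g = 0}"

text \<open>
  The boundary function of \<open>w \<mapsto> q(0, w)\<close>: for almost every \<open>w\<close>, \<open>q(\<cdot>, w)\<close> is a Hardy function of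
  one variable, whose value at the centre of the disc is its mean over the circle. In terms of
  Fourier series it keeps the terms with \<open>z\<close>-exponent 0; see \<open>fourier_slice_zero\<close>.
\<close>

definition slice_zero :: "(complex \<times> complex \<Rightarrow> complex) \<Rightarrow> (complex \<Rightarrow> complex)" where
  "slice_zero q = (\<lambda>w. LINT z|circle. q (z, w))"

text \<open>
  The backward shift \<open>a\<^sub>0 + a\<^sub>1 w + a\<^sub>2 w\<^sup>2 + \<dots> \<mapsto> a\<^sub>1 + a\<^sub>2 w + \<dots>\<close>, written on boundary functions as
  \<open>(f(w) - a\<^sub>0) / w\<close>; see \<open>fourier_backward_shift\<close>.
\<close>

definition backward_shift :: "(complex \<Rightarrow> complex) \<Rightarrow> (complex \<Rightarrow> complex)" where
  "backward_shift f = (\<lambda>w. (f w - fourier_circle f 0) / w)"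

lemma measurable_cis [measurable]: "cis \<in> borel_measurable borel"
  by (intro borel_measurable_continuous_onI continuous_intros)

lemma measurable_cnj [measurable]: "cnj \<in> borel_measurable borel"
  by (intro borel_measurable_continuous_onI continuous_intros)

lemma prob_space_circle: "prob_space circle"
  unfolding circle_def
  by (intro prob_space.prob_space_distr prob_space_uniform_measure) auto

lemma sets_circle [measurable_cong, simp]: "sets circle = sets borel"
  by (simp add: circle_def)

lemma space_circle [simp]: "space circle = UNIV"
  by (simp add: circle_def)

lemma AE_circle: "AE w in circle. cmod w = 1"
  unfolding circle_def by (subst AE_distr_iff) auto

lemma prob_space_torus: "prob_space torus"
proof -
  interpret prob_space circle by (rule prob_space_circle)
  interpret pair_prob_space circle circle ..
  show ?thesis unfolding torus_def by unfold_locales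
qed

lemma sets_torus [measurable_cong]: "sets torus = sets (borel \<Otimes>\<^sub>M borel)"
  unfolding torus_def by (intro sets_pair_measure_cong) auto

lemma AE_torus: "AE x in torus. cmod (fst x) = 1 \<and> cmod (snd x) = 1"
proof -
  interpret prob_space circle by (rule prob_space_circle)
  interpret pair_prob_space circle circle ..
  have "AE x in circle \<Otimes>\<^sub>M circle. (\<lambda>x. cmod (fst x) = 1 \<and> cmod (snd x) = 1) x"
  proof (rule AE_pair_measure)
    show "{x \<in> space (circle \<Otimes>\<^sub>M circle). cmod (fst x) = 1 \<and> cmod (snd x) = 1}
        \<in> sets (circle \<Otimes>\<^sub>M circle)" by measurable
    show "AE x in circle. AE y in circle. cmod (fst (x, y)) = 1 \<and> cmod (snd (x, y)) = 1"
      using AE_circle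
    proof eventually_elim
      case (elim x)
      show ?case using AE_circle by eventually_elim (simp add: elim)
    qed
  qed
  then show ?thesis unfolding torus_def by simp
qed

lemma L2_integrable:
  assumes "prob_space M" "f \<in> L2 M"
  shows "integrable M f"
proof -
  interpret prob_space M by fact
  have "integrable M (\<lambda>x. 1 + (cmod (f x))\<^sup>2)" using assms(2) by (auto simp: L2_def)
  then show ?thesis
  proof (rule Bochner_Integration.integrable_bound)
    show "f \<in> borel_measurable M" using assms(2) by (auto simp: L2_def)
    have "cmod (f x) \<le> 1 + (cmod (f x))\<^sup>2" for x
      using zero_le_power2[of "cmod (f x) - 1/2"] by (simp add: power2_eq_square algebra_simps)
    then show "AE x in M. norm (f x) \<le> norm (1 + (cmod (f x))\<^sup>2)" by (intro AE_I2) simp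
  qed
qed

lemma fourier_slice_zero:
  assumes "q \<in> L2 torus"
  shows "fourier_circle (slice_zero q) n = fourier_torus q 0 n"
proof -
  interpret prob_space circle by (rule prob_space_circle)
  interpret pair_prob_space circle circle ..
  have q: "integrable torus q" using L2_integrable[OF prob_space_torus assms] .
  have [measurable]: "q \<in> borel_measurable torus" using assms by (auto simp: L2_def)
  have "integrable torus (\<lambda>x. q x * cnj (snd x powi n))"
  proof (rule Bochner_Integration.integrable_bound[OF q])
    show "(\<lambda>x. q x * cnj (snd x powi n)) \<in> borel_measurable torus"
      unfolding power_int_def by measurable
    show "AE x in torus. norm (q x * cnj (snd x powi n)) \<le> norm (q x)"
      using AE_torus by eventually_elim (simp add: norm_mult norm_power_int)
  qed
  then have "integrable (circle \<Otimes>\<^sub>M circle) (\<lambda>(z, w). q (z, w) * cnj (w powi n))"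
    by (simp add: torus_def case_prod_beta')
  from integral_snd[OF this]
  have "(LINT w|circle. LINT z|circle. q (z, w) * cnj (w powi n)) =
      (LINT x|torus. (case x of (z, w) \<Rightarrow> q (z, w) * cnj (w powi n)))"
    unfolding torus_def .
  also have "(\<lambda>x. case x of (z, w) \<Rightarrow> q (z, w) * cnj (w powi n)) =
      (\<lambda>x. q x * cnj (case x of (z, w) \<Rightarrow> z powi 0 * w powi n))"
    by (rule ext) (simp split: prod.split)
  finally show ?thesis
    by (simp only: fourier_circle_def fourier_torus_def L2_inner_def slice_zero_def
        integral_mult_left_zero)
qed

lemma integral_powi_circle: "(LINT w|circle. w powi n) = (if n = 0 then 1 else 0)"
proof (cases "n = 0")
  case True
  interpret prob_space circle by (rule prob_space_circle)
  show ?thesis using True prob_space by simp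
next
  case False
  have "((\<lambda>t. cis (of_int n * t)) has_integral
      (- \<i> / of_int n * cis (of_int n * (2 * pi)) - (- \<i> / of_int n * cis (of_int n * 0)))) {0..2 * pi}"
  proof (rule fundamental_theorem_of_calculus)
    fix t :: real
    have "((\<lambda>z. - \<i> / of_int n * exp (\<i> * of_int n * z)) has_field_derivative
        exp (\<i> * of_int n * of_real t)) (at (of_real t))"
      using False by (auto intro!: derivative_eq_intros)
    from has_vector_derivative_real_field[OF this]
    show "((\<lambda>t. - \<i> / of_int n * cis (of_int n * t)) has_vector_derivative cis (of_int n * t))
        (at t within {0..2 * pi})"
      by (simp add: cis_conv_exp mult.assoc)
  qed simp
  moreover have "cis (of_int n * (2 * pi)) = 1"
    using cis_multiple_2pi[of "of_int n"] by (simp add: mult.commute)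
  ultimately have 1: "((\<lambda>t. cis (of_int n * t)) has_integral 0) {0..2 * pi}" by simp
  have "set_integrable lborel {0..2 * pi} (\<lambda>t. cis (of_int n * t))"
    by (rule borel_integrable_atLeastAtMost') (intro continuous_intros)
  from set_borel_integral_eq_integral(2)[OF this]
  have 2: "(LINT t:{0..2 * pi}|lborel. cis (of_int n * t)) = 0"
    using 1 by (simp add: integral_unique)
  have "(LINT w|circle. w powi n) =
      (LINT t|uniform_measure lborel {0..2 * pi}. cis t powi n)"
    unfolding circle_def power_int_def by (subst integral_distr) auto
  also have "\<dots> = (LINT t|uniform_measure lborel {0..2 * pi}. cis (of_int n * t))"
    by (simp add: cis_power_int mult.commute)
  also have "\<dots> = 0"
  proof -
    have "uniform_measure lborel {0..2 * pi} =
        density lborel (\<lambda>t. ennreal (indicator {0..2 * pi} t / (2 * pi)))"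
      unfolding uniform_measure_def
      by (intro arg_cong[where f = "density lborel"] ext)
         (auto split: split_indicator simp: divide_ennreal ennreal_1[symmetric] simp del: ennreal_1)
    moreover have "(LINT t|density lborel (\<lambda>t. ennreal (indicator {0..2 * pi} t / (2 * pi))). cis (of_int n * t)) =
        (LINT t|lborel. (1 / (2 * pi)) *\<^sub>R (indicator {0..2 * pi} t *\<^sub>R cis (of_int n * t)))"
      by (subst integral_density) (auto intro!: Bochner_Integration.integral_cong)
    ultimately show ?thesis
      using 2 by (simp only: set_lebesgue_integral_def integral_scaleR_right) simp
  qed
  finally show ?thesis using False by simp
qed

lemma fourier_backward_shift:
  assumes "f \<in> L2 circle"
  shows "fourier_circle (backward_shift f) n = (if n = -1 then 0 else fourier_circle f (n + 1))"
proof -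
  interpret prob_space circle by (rule prob_space_circle)
  have f: "integrable circle f" using L2_integrable[OF prob_space_circle assms] .
  have [measurable]: "f \<in> borel_measurable borel"
    using assms by (auto simp: L2_def cong: measurable_cong_sets)
  have pw: "cnj (w powi n) / w = cnj (w powi (n + 1))" if "cmod w = 1" for w :: complex
  proof -
    have "w \<noteq> 0" using that by auto
    moreover have "inverse w = cnj w" 
      using that by (metis complex_norm_square inverse_unique of_real_1 power_one)
    ultimately show ?thesis by (simp add: power_int_add divide_inverse)
  qed
  have int1: "integrable circle (\<lambda>w. g w * cnj (w powi (n + 1)))"
    if "integrable circle g" for g
  proof (rule Bochner_Integration.integrable_bound[OF that])
    have [measurable]: "g \<in> borel_measurable circle" using that by auto
    show "(\<lambda>w. g w * cnj (w powi (n + 1))) \<in> borel_measurable circle"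
      unfolding power_int_def by measurable
    show "AE w in circle. norm (g w * cnj (w powi (n + 1))) \<le> norm (g w)"
      using AE_circle by eventually_elim (simp add: norm_mult norm_power_int)
  qed
  have "fourier_circle (backward_shift f) n =
      (LINT w|circle. f w * cnj (w powi (n + 1)) - fourier_circle f 0 * cnj (w powi (n + 1)))"
    unfolding fourier_circle_def[of "backward_shift f"] L2_inner_def
  proof (rule integral_cong_AE)
    show "(\<lambda>w. backward_shift f w * cnj (w powi n)) \<in> borel_measurable circle"
      unfolding power_int_def backward_shift_def by measurable
    show "(\<lambda>w. f w * cnj (w powi (n + 1)) - fourier_circle f 0 * cnj (w powi (n + 1)))
        \<in> borel_measurable circle"
      unfolding power_int_def by measurable
    show "AE w in circle. backward_shift f w * cnj (w powi n) =
        f w * cnj (w powi (n + 1)) - fourier_circle f 0 * cnj (w powi (n + 1))"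
      using AE_circle
    proof eventually_elim
      case (elim w)
      have "backward_shift f w * cnj (w powi n) =
          (f w - fourier_circle f 0) * (cnj (w powi n) / w)"
        by (simp add: backward_shift_def)
      then show ?case by (simp only: pw[OF elim] left_diff_distrib)
    qed
  qed
  also have "\<dots> = fourier_circle f (n + 1) -
      fourier_circle f 0 * (LINT w|circle. 1 * cnj (w powi (n + 1)))"
    using int1[OF f] int1[of "\<lambda>_. 1"]
    by (subst Bochner_Integration.integral_diff) (auto simp: fourier_circle_def L2_inner_def)
  also have "(LINT w|circle. 1 * cnj (w powi (n + 1))) = (if n = -1 then 1 else 0)"
  proof -
    have "(LINT w|circle. 1 * cnj (w powi (n + 1))) = cnj (LINT w|circle. w powi (n + 1))"
      by (simp only: mult_1 Bochner_Integration.integral_cnj)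
    moreover have "n + 1 = 0 \<longleftrightarrow> n = -1" by linarith
    ultimately show ?thesis by (simp only: integral_powi_circle) simp
  qed
  finally show ?thesis by auto
qed

end

theory Submission
  imports Defs
begin

text \<open>
  Let \<open>p\<^sub>n = \<Sum>\<^bsub>i\<le>n\<^esub> z\<^sup>i w\<^bsup>n-i\<^esup>\<close>. The proof reduces both sides of the equivalence to the same scalar
  condition on single functions of \<open>W\<close>, namely \<open>\<langle>w\<^sup>n q, q\<rangle> = 0\<close> for all \<open>n \<ge> 1\<close>.

  Analytic side. If \<open>q = \<Sum> a\<^sub>n p\<^sub>n\<close>, collecting powers of \<open>z\<close> gives
  \<open>q(z, w) = \<Sum>\<^sub>j z\<^sup>j f\<^sub>j(w)\<close> with \<open>f\<^sub>j(w) = \<Sum>\<^sub>k a\<^bsub>j+k\<^esub> w\<^sup>k\<close>, the \<open>j\<close>-th backward shift of \<open>q(0, \<cdot>)\<close>. So the iterated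
  backward shifts of \<open>q(0, \<cdot>)\<close>, taken at \<open>w\<close>, are the Fourier coefficients of the slice \<open>q(\<cdot>, w)\<close>
  (\<open>backward_shift_iterate_slice\<close>). By Parseval's identity on
  almost every slice, the sum in the theorem equals \<open>\<integral> |q(z, w)|\<^sup>2 dz\<close>
  (\<open>backward_shift_energy\<close>). This integrable real function of \<open>w\<close> has Fourier coefficients
  \<open>\<langle>q, w\<^sup>n q\<rangle>\<close>, so, by uniqueness of Fourier series of integrable functions
  (\<open>fourier_circle_unique\<close>), it is constant exactly when those with \<open>n \<ge> 1\<close> vanish
  (\<open>constant_energy_iff\<close>).

  Operator side. For \<open>f\<close> and \<open>h\<close> in the diagonal space, \<open>\<langle>w\<^sup>k B f, h\<rangle> = \<langle>w\<^bsup>k+1\<^esup> f, h\<rangle>\<close>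
  (\<open>L2_inner_bergman_shift\<close>), so \<open>\<langle>B\<^sup>n f, h\<rangle> = \<langle>w\<^sup>n f, h\<rangle>\<close>: powers of the compressed operator \<open>B\<close> may be
  replaced by honest multiplications. A function orthogonal to \<open>B M\<close> is therefore
  orthogonal to all \<open>w\<^sup>n M\<close> with \<open>n \<ge> 1\<close>, in particular to \<open>w\<^sup>n q\<close>
  (\<open>wandering_orthogonal_shifts\<close>). Conversely, polarisation turns \<open>\<langle>w\<^sup>n q, q\<rangle> = 0\<close> into
  \<open>\<langle>w\<^sup>n f, g\<rangle> = 0\<close> for all \<open>f\<close>, \<open>g\<close> in \<open>W\<close>, and then \<open>W\<close> is the wandering subspace of the smallest
  invariant subspace containing it (\<open>wandering_subspace_exists\<close>).

  The Hilbert space facts that carry this argument (completeness of \<open>L\<^sup>2\<close>, orthogonal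
  projection, Parseval's identity) are proved for functions rather than for classes modulo null
  sets; equalities of vectors become equalities almost everywhere.
\<close>

section \<open>Inner product and norm on square-integrable functions\<close>

lemma L2_borel [measurable_dest]: "f \<in> L2 M \<Longrightarrow> f \<in> borel_measurable M"
  by (simp add: L2_def)

lemma L2_sq_integrable: "f \<in> L2 M \<Longrightarrow> integrable M (\<lambda>x. (cmod (f x))\<^sup>2)"
  by (simp add: L2_def)

lemma L2_I_bound:
  assumes [measurable]: "f \<in> borel_measurable M" and "integrable M g"
    and "\<And>x. (cmod (f x))\<^sup>2 \<le> g x"
  shows "f \<in> L2 M"
  unfolding L2_def
proof (safe)
  show "integrable M (\<lambda>x. (cmod (f x))\<^sup>2)"
    by (rule Bochner_Integration.integrable_bound[OF assms(2)])
       (use order_trans[OF assms(3) abs_ge_self] in auto)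
qed fact

lemma cmod_add_sq_le: "(cmod (a + b))\<^sup>2 \<le> 2 * (cmod a)\<^sup>2 + 2 * (cmod b)\<^sup>2"
proof -
  have "(cmod (a + b))\<^sup>2 \<le> (cmod a + cmod b)\<^sup>2"
    by (intro power_mono norm_triangle_ineq) auto
  also have "\<dots> \<le> 2 * (cmod a)\<^sup>2 + 2 * (cmod b)\<^sup>2"
    using zero_le_power2[of "cmod a - cmod b"] by (simp add: power2_eq_square algebra_simps)
  finally show ?thesis .
qed

lemma L2_zero [simp]: "(\<lambda>x. 0) \<in> L2 M"
  by (simp add: L2_def)

lemma L2_add:
  assumes f: "f \<in> L2 M" and g: "g \<in> L2 M"
  shows "(\<lambda>x. f x + g x) \<in> L2 M"
proof (rule L2_I_bound)
  show "(\<lambda>x. f x + g x) \<in> borel_measurable M"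
    using f g by measurable
  show "integrable M (\<lambda>x. 2 * (cmod (f x))\<^sup>2 + 2 * (cmod (g x))\<^sup>2)"
    using f g by (auto simp: L2_def)
qed (rule cmod_add_sq_le)

lemma L2_scale: "f \<in> L2 M \<Longrightarrow> (\<lambda>x. c * f x) \<in> L2 M"
  by (auto simp: L2_def norm_mult power_mult_distrib)

lemma L2_diff:
  assumes "f \<in> L2 M" "g \<in> L2 M"
  shows "(\<lambda>x. f x - g x) \<in> L2 M"
  using L2_add[OF assms(1) L2_scale[OF assms(2), of "-1"]] by simp

lemma L2_sum: "(\<And>i. i \<in> I \<Longrightarrow> f i \<in> L2 M) \<Longrightarrow> (\<lambda>x. \<Sum>i\<in>I. f i x) \<in> L2 M"
proof (induction I rule: infinite_finite_induct)
  case (insert i I)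
  then show ?case using L2_add[of "f i" M "\<lambda>x. \<Sum>i\<in>I. f i x"] by simp
qed simp_all

lemma L2_inner_integrable:
  assumes f: "f \<in> L2 M" and g: "g \<in> L2 M"
  shows "integrable M (\<lambda>x. f x * cnj (g x))"
proof (rule Bochner_Integration.integrable_bound)
  show "integrable M (\<lambda>x. (cmod (f x))\<^sup>2 + (cmod (g x))\<^sup>2)"
    using f g by (auto simp: L2_def)
  show "(\<lambda>x. f x * cnj (g x)) \<in> borel_measurable M"
    using f g by measurable
  have "cmod a * cmod b \<le> (cmod a)\<^sup>2 + (cmod b)\<^sup>2" for a b
    using zero_le_power2[of "cmod a - cmod b"]
      mult_nonneg_nonneg[OF norm_ge_zero[of a] norm_ge_zero[of b]]
    by (simp add: power2_eq_square algebra_simps del: mult_nonneg_nonneg)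
  then show "AE x in M. norm (f x * cnj (g x)) \<le> norm ((cmod (f x))\<^sup>2 + (cmod (g x))\<^sup>2)"
    by (intro AE_I2) (simp add: norm_mult)
qed

lemma L2_inner_commute: "L2_inner M g f = cnj (L2_inner M f g)"
  unfolding L2_inner_def by (subst Bochner_Integration.integral_cnj[symmetric]) (simp add: mult.commute)

lemma L2_inner_add_left:
  assumes "f \<in> L2 M" "g \<in> L2 M" "h \<in> L2 M"
  shows "L2_inner M (\<lambda>x. f x + g x) h = L2_inner M f h + L2_inner M g h"
  unfolding L2_inner_def using assms
  by (simp add: distrib_right L2_inner_integrable)

lemma L2_inner_diff_left:
  assumes "f \<in> L2 M" "g \<in> L2 M" "h \<in> L2 M"
  shows "L2_inner M (\<lambda>x. f x - g x) h = L2_inner M f h - L2_inner M g h"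
  unfolding L2_inner_def using assms
  by (simp add: left_diff_distrib L2_inner_integrable)

lemma L2_inner_scale_left: "L2_inner M (\<lambda>x. c * f x) h = c * L2_inner M f h"
  unfolding L2_inner_def by (simp add: mult.assoc)

lemma L2_inner_zero_left [simp]: "L2_inner M (\<lambda>x. 0) h = 0"
  by (simp add: L2_inner_def)

lemma L2_inner_sum_left:
  assumes "\<And>i. i \<in> I \<Longrightarrow> f i \<in> L2 M" "h \<in> L2 M"
  shows "L2_inner M (\<lambda>x. \<Sum>i\<in>I. f i x) h = (\<Sum>i\<in>I. L2_inner M (f i) h)"
  unfolding L2_inner_def using assms
  by (simp add: sum_distrib_right L2_inner_integrable)

lemma L2_inner_add_right:
  assumes "f \<in> L2 M" "g \<in> L2 M" "h \<in> L2 M"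
  shows "L2_inner M h (\<lambda>x. f x + g x) = L2_inner M h f + L2_inner M h g"
  using L2_inner_add_left[OF assms] by (simp add: L2_inner_commute[of M h])

lemma L2_inner_diff_right:
  assumes "f \<in> L2 M" "g \<in> L2 M" "h \<in> L2 M"
  shows "L2_inner M h (\<lambda>x. f x - g x) = L2_inner M h f - L2_inner M h g"
  using L2_inner_diff_left[OF assms] by (simp add: L2_inner_commute[of M h])

lemma L2_inner_scale_right: "L2_inner M h (\<lambda>x. c * f x) = cnj c * L2_inner M h f"
  using L2_inner_scale_left[of M c f h] by (simp add: L2_inner_commute[of M h])

lemma L2_inner_sum_right:
  assumes "\<And>i. i \<in> I \<Longrightarrow> f i \<in> L2 M" "h \<in> L2 M"
  shows "L2_inner M h (\<lambda>x. \<Sum>i\<in>I. f i x) = (\<Sum>i\<in>I. L2_inner M h (f i))"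
proof -
  have "L2_inner M h (\<lambda>x. \<Sum>i\<in>I. f i x) = cnj (\<Sum>i\<in>I. L2_inner M (f i) h)"
    by (subst L2_inner_commute) (simp only: L2_inner_sum_left[OF assms])
  then show ?thesis by (simp add: L2_inner_commute[of M h])
qed

lemma L2_norm_nonneg [simp]: "0 \<le> L2_norm M f"
  by (simp add: L2_norm_def)

lemma L2_norm_sq: "(L2_norm M f)\<^sup>2 = (LINT x|M. (cmod (f x))\<^sup>2)"
  by (simp add: L2_norm_def)

lemma L2_inner_self: "L2_inner M f f = of_real ((L2_norm M f)\<^sup>2)"
  unfolding L2_norm_sq L2_inner_def
  by (simp add: complex_norm_square[symmetric] del: of_real_power)

lemma L2_norm_scale: "L2_norm M (\<lambda>x. c * f x) = cmod c * L2_norm M f"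
  by (simp add: L2_norm_def norm_mult power_mult_distrib real_sqrt_mult)

lemma L2_norm_minus_commute: "L2_norm M (\<lambda>x. f x - g x) = L2_norm M (\<lambda>x. g x - f x)"
  by (simp add: L2_norm_def norm_minus_commute)

lemma L2_norm_eq_0_iff:
  assumes "f \<in> L2 M"
  shows "L2_norm M f = 0 \<longleftrightarrow> (AE x in M. f x = 0)"
  unfolding L2_norm_def
  using integral_nonneg_eq_0_iff_AE[OF L2_sq_integrable[OF assms]] by simp

lemma L2_norm_sq_add:
  assumes f: "f \<in> L2 M" and g: "g \<in> L2 M"
  shows "(L2_norm M (\<lambda>x. f x + g x))\<^sup>2 = (L2_norm M f)\<^sup>2 + 2 * Re (L2_inner M f g) + (L2_norm M g)\<^sup>2"
proof -
  have "L2_inner M (\<lambda>x. f x + g x) (\<lambda>x. f x + g x) =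
      L2_inner M f f + (L2_inner M f g + cnj (L2_inner M f g)) + L2_inner M g g"
    using f g L2_add[OF f g]
    by (simp add: L2_inner_add_left L2_inner_add_right L2_inner_commute[of M g f])
  also have "L2_inner M f g + cnj (L2_inner M f g) = of_real (2 * Re (L2_inner M f g))"
    by (simp add: complex_add_cnj)
  finally show ?thesis
    unfolding L2_inner_self of_real_add[symmetric] of_real_eq_iff .
qed

lemma L2_norm_sq_diff:
  assumes f: "f \<in> L2 M" and g: "g \<in> L2 M"
  shows "(L2_norm M (\<lambda>x. f x - g x))\<^sup>2 = (L2_norm M f)\<^sup>2 - 2 * Re (L2_inner M f g) + (L2_norm M g)\<^sup>2"
  using L2_norm_sq_add[OF f L2_scale[OF g, of "-1"]]
  unfolding L2_norm_scale L2_inner_scale_right by simp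

text \<open>
  The square norm of \<open>f - c g\<close> is nonnegative; the best choice \<open>c = \<langle>f, g\<rangle> / \<parallel>g\<parallel>\<^sup>2\<close> gives the
  inequality. When \<open>\<parallel>g\<parallel> = 0\<close> the function \<open>g\<close> vanishes only almost everywhere, which is enough for
  the inner product to vanish.
\<close>

lemma L2_Cauchy_Schwarz:
  assumes f: "f \<in> L2 M" and g: "g \<in> L2 M"
  shows "cmod (L2_inner M f g) \<le> L2_norm M f * L2_norm M g"
proof (cases "L2_norm M g = 0")
  case True
  then have ae: "AE x in M. g x = 0" using L2_norm_eq_0_iff[OF g] by simp
  have "L2_inner M f g = (LINT x|M. 0)"
    unfolding L2_inner_def
    by (rule integral_cong_AE) (use f g ae in \<open>auto elim: eventually_mono\<close>)
  then show ?thesis using True by simp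
next
  case False
  define B where "B = (L2_norm M g)\<^sup>2"
  define i where "i = L2_inner M f g"
  define c where "c = i / of_real B"
  have B: "B > 0" using False by (simp add: B_def)
  have "0 \<le> (L2_norm M (\<lambda>x. f x - c * g x))\<^sup>2" by simp
  also have "\<dots> = (L2_norm M f)\<^sup>2 - 2 * Re (cnj c * i) + (cmod c)\<^sup>2 * B"
    using f g by (simp add: L2_norm_sq_diff L2_scale L2_inner_scale_right L2_norm_scale
        power_mult_distrib i_def B_def)
  also have "cnj c * i = of_real ((cmod i)\<^sup>2 / B)"
    unfolding c_def using complex_norm_square[of i] by (simp add: mult.commute)
  also have "(cmod c)\<^sup>2 * B = (cmod i)\<^sup>2 / B"
    using B unfolding c_def by (simp add: norm_divide power_divide power2_eq_square)
  finally have "(cmod i)\<^sup>2 / B \<le> (L2_norm M f)\<^sup>2" by simp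
  then have "(cmod i)\<^sup>2 \<le> (L2_norm M f * L2_norm M g)\<^sup>2"
    using B by (simp add: field_simps B_def power_mult_distrib)
  then show ?thesis unfolding i_def by (rule power2_le_imp_le) simp
qed

lemma L2_norm_triangle:
  assumes f: "f \<in> L2 M" and g: "g \<in> L2 M"
  shows "L2_norm M (\<lambda>x. f x + g x) \<le> L2_norm M f + L2_norm M g"
proof (rule power2_le_imp_le)
  have "Re (L2_inner M f g) \<le> L2_norm M f * L2_norm M g"
    using L2_Cauchy_Schwarz[OF f g] complex_Re_le_cmod order_trans by blast
  then show "(L2_norm M (\<lambda>x. f x + g x))\<^sup>2 \<le> (L2_norm M f + L2_norm M g)\<^sup>2"
    unfolding L2_norm_sq_add[OF f g] by (simp add: power2_eq_square algebra_simps)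
qed simp

lemma L2_norm_triangle_diff:
  assumes "f \<in> L2 M" "g \<in> L2 M" "h \<in> L2 M"
  shows "L2_norm M (\<lambda>x. f x - h x) \<le> L2_norm M (\<lambda>x. f x - g x) + L2_norm M (\<lambda>x. g x - h x)"
  using L2_norm_triangle[OF L2_diff[OF assms(1,2)] L2_diff[OF assms(2,3)]] by simp

lemma L2_inner_tendsto_left:
  assumes "\<And>n. u n \<in> L2 M" "f \<in> L2 M" "h \<in> L2 M"
    and "(\<lambda>n. L2_norm M (\<lambda>x. u n x - f x)) \<longlonglongrightarrow> 0"
  shows "(\<lambda>n. L2_inner M (u n) h) \<longlonglongrightarrow> L2_inner M f h"
proof -
  have "(\<lambda>n. L2_inner M (u n) h - L2_inner M f h) \<longlonglongrightarrow> 0"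
  proof (rule Lim_null_comparison)
    show "(\<lambda>n. L2_norm M (\<lambda>x. u n x - f x) * L2_norm M h) \<longlonglongrightarrow> 0"
      using tendsto_mult_left_zero[OF assms(4)] .
    show "\<forall>\<^sub>F n in sequentially. norm (L2_inner M (u n) h - L2_inner M f h)
        \<le> L2_norm M (\<lambda>x. u n x - f x) * L2_norm M h"
      using L2_Cauchy_Schwarz[OF L2_diff[OF assms(1,2)] assms(3)] assms
      by (simp add: L2_inner_diff_left)
  qed
  then show ?thesis by (simp add: LIM_zero_iff)
qed

lemma L2_mult_unimodular:
  assumes "f \<in> L2 M" "g \<in> borel_measurable M" "AE x in M. cmod (g x) = 1"
  shows "(\<lambda>x. g x * f x) \<in> L2 M"
  unfolding L2_def
proof (safe)
  show [measurable]: "(\<lambda>x. g x * f x) \<in> borel_measurable M"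
    using assms(1,2) by measurable
  have [measurable]: "f \<in> borel_measurable M" using assms(1) by measurable
  have "AE x in M. (cmod (f x))\<^sup>2 = (cmod (g x * f x))\<^sup>2"
    using assms(3) by eventually_elim (simp add: norm_mult)
  then show "integrable M (\<lambda>x. (cmod (g x * f x))\<^sup>2)"
    using L2_sq_integrable[OF assms(1)]
    by (rule iffD1[OF Bochner_Integration.integrable_cong_AE, rotated 2]) measurable
qed

lemma L2_const: "prob_space M \<Longrightarrow> (\<lambda>x. c) \<in> L2 M"
  by (simp add: L2_def finite_measure.integrable_const prob_space.finite_measure)

section \<open>Completeness and orthogonal projection\<close>

text \<open>
  The Riesz--Fischer theorem. A subsequence with increments of norm below \<open>4\<^sup>-\<^sup>k\<close> converges
  pointwise almost everywhere: the sum of the \<open>4\<^sup>k\<close>-weighted squared increments has finite integral, so the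
  increments themselves are \<open>O(2\<^sup>-\<^sup>k)\<close> at almost every point.
\<close>

lemma L2_complete:
  assumes u: "\<And>n. u n \<in> L2 M"
    and cauchy: "\<And>e. e > 0 \<Longrightarrow> \<exists>N. \<forall>m\<ge>N. \<forall>n\<ge>N. L2_norm M (\<lambda>x. u m x - u n x) < e"
  obtains f where "f \<in> L2 M" "(\<lambda>n. L2_norm M (\<lambda>x. u n x - f x)) \<longlonglongrightarrow> 0"
proof -
  note [measurable] = L2_borel[OF u]
  have "\<exists>N. \<forall>m\<ge>N. \<forall>n\<ge>N. L2_norm M (\<lambda>x. u m x - u n x) < (1/4) ^ k" for k :: nat
    using cauchy[of "(1/4) ^ k"] by simp
  then obtain N where N: "\<And>k m n. m \<ge> N k \<Longrightarrow> n \<ge> N k \<Longrightarrow> L2_norm M (\<lambda>x. u m x - u n x) < (1/4) ^ k"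
    by metis
  \<comment> \<open>The summand \<open>k\<close> makes the indices of the subsequence tend to infinity.\<close>
  define r where "r k = (\<Sum>i\<le>k. N i) + k" for k
  have rN: "N k \<le> r k" for k
    unfolding r_def using member_le_sum[of k "{..k}" N] by simp
  have rSuc: "r k \<le> r (Suc k)" for k unfolding r_def by simp
  have rk: "k \<le> r k" for k unfolding r_def by simp
  define d where "d k x = (cmod (u (r (Suc k)) x - u (r k) x))\<^sup>2" for k x
  have d_int: "integrable M (d k)" for k
    unfolding d_def using L2_diff[OF u u] by (rule L2_sq_integrable)
  have [measurable]: "d k \<in> borel_measurable M" for k unfolding d_def by measurable
  have d_le: "(LINT x|M. d k x) \<le> (1/16) ^ k" for k
  proof -
    have "L2_norm M (\<lambda>x. u (r (Suc k)) x - u (r k) x) \<le> (1/4) ^ k"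
      using N[of k "r (Suc k)" "r k"] rN[of k] rSuc[of k] by simp
    then have "(L2_norm M (\<lambda>x. u (r (Suc k)) x - u (r k) x))\<^sup>2 \<le> ((1/4) ^ k)\<^sup>2"
      by (intro power_mono) auto
    also have "((1/4) ^ k)\<^sup>2 = ((1/16) ^ k :: real)"
      by (simp add: power_mult[symmetric] mult.commute[of k]) (simp add: power_mult power2_eq_square)
    finally show ?thesis by (simp add: L2_norm_sq d_def)
  qed
  have "(\<integral>\<^sup>+x. (\<Sum>k. ennreal (4 ^ k * d k x)) \<partial>M) = (\<Sum>k. \<integral>\<^sup>+x. ennreal (4 ^ k * d k x) \<partial>M)"
    by (rule nn_integral_suminf) simp
  also have "\<dots> \<le> (\<Sum>k. ennreal ((1/4) ^ k))"
  proof (intro suminf_le summableI)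
    fix k
    have "(\<integral>\<^sup>+x. ennreal (4 ^ k * d k x) \<partial>M) = ennreal (LINT x|M. 4 ^ k * d k x)"
      by (intro nn_integral_eq_integral AE_I2 Bochner_Integration.integrable_mult_right d_int)
        (simp add: d_def)
    also have "\<dots> \<le> ennreal (4 ^ k * (1/16) ^ k)"
      using d_le[of k] by (intro ennreal_leI) simp
    also have "4 ^ k * (1/16) ^ k = ((1/4) ^ k :: real)"
      by (simp flip: power_mult_distrib)
    finally show "(\<integral>\<^sup>+x. ennreal (4 ^ k * d k x) \<partial>M) \<le> ennreal ((1/4) ^ k)" .
  qed
  also have "\<dots> < \<infinity>"
    by (subst suminf_ennreal2) (auto intro!: summable_geometric)
  finally have "AE x in M. (\<Sum>k. ennreal (4 ^ k * d k x)) \<noteq> \<infinity>"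
    by (intro nn_integral_noteq_infinite) auto
  then have conv: "AE x in M. convergent (\<lambda>k. u (r k) x)"
  proof eventually_elim
    case (elim x)
    then have "summable (\<lambda>k. 4 ^ k * d k x)"
      by (intro summable_suminf_not_top) (auto simp: d_def)
    then have "Bseq (\<lambda>k. 4 ^ k * d k x)"
      by (intro convergent_imp_Bseq convergentI[of _ 0] summable_LIMSEQ_zero)
    then obtain K where K: "K > 0" "\<And>k. 4 ^ k * d k x \<le> K"
      by (auto simp: Bseq_def d_def)
    have "norm (u (r (Suc k)) x - u (r k) x) \<le> sqrt K * (1/2) ^ k" for k
    proof (rule power2_le_imp_le)
      have "d k x \<le> K * (1/4) ^ k"
        using K(2)[of k] by (simp add: field_simps)
      also have "\<dots> = (sqrt K * (1/2) ^ k)\<^sup>2"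
        using K(1) by (simp add: power_mult_distrib power_mult[symmetric] mult.commute[of k])
          (simp add: power_mult power2_eq_square)
      finally show "(norm (u (r (Suc k)) x - u (r k) x))\<^sup>2 \<le> (sqrt K * (1/2) ^ k)\<^sup>2"
        by (simp add: d_def)
    qed (use K in simp)
    moreover have "summable (\<lambda>k. sqrt K * (1/2) ^ k)"
      by (intro summable_mult summable_geometric) simp
    ultimately have "summable (\<lambda>k. u (r (Suc k)) x - u (r k) x)"
      by (rule summable_comparison_test'[where N = 0, rotated])
    then have "convergent (\<lambda>n. \<Sum>k<n. u (r (Suc k)) x - u (r k) x)"
      by (simp add: summable_iff_convergent)
    then have "convergent (\<lambda>n. u (r n) x - u (r 0) x)"
      using sum_lessThan_telescope[of "\<lambda>k. u (r k) x"] by simp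
    from convergent_add[OF this convergent_const[of "u (r 0) x"]] show ?case by simp
  qed
  define f where "f x = lim (\<lambda>k. u (r k) x)" for x
  have [measurable]: "f \<in> borel_measurable M"
    unfolding f_def by measurable
  have lim: "AE x in M. (\<lambda>k. u (r k) x) \<longlonglongrightarrow> f x"
    using conv unfolding f_def by eventually_elim (simp add: convergent_LIMSEQ_iff)
  \<comment> \<open>Fatou's lemma turns the Cauchy bound into a bound on the distance to the pointwise limit.\<close>
  have fatou: "(\<integral>\<^sup>+x. ennreal ((cmod (u n x - f x))\<^sup>2) \<partial>M) \<le> ennreal (e\<^sup>2)"
    if "\<And>k. k \<ge> K \<Longrightarrow> L2_norm M (\<lambda>x. u n x - u (r k) x) \<le> e" for n K e
  proof -
    have "(\<integral>\<^sup>+x. ennreal ((cmod (u n x - f x))\<^sup>2) \<partial>M)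
        = (\<integral>\<^sup>+x. liminf (\<lambda>k. ennreal ((cmod (u n x - u (r k) x))\<^sup>2)) \<partial>M)"
    proof (rule nn_integral_cong_AE, use lim in eventually_elim)
      case (elim x)
      then have "(\<lambda>k. ennreal ((cmod (u n x - u (r k) x))\<^sup>2)) \<longlonglongrightarrow> ennreal ((cmod (u n x - f x))\<^sup>2)"
        by (intro tendsto_intros) auto
      from lim_imp_Liminf[OF _ this] show ?case by simp
    qed
    also have "\<dots> \<le> liminf (\<lambda>k. \<integral>\<^sup>+x. ennreal ((cmod (u n x - u (r k) x))\<^sup>2) \<partial>M)"
      by (intro nn_integral_liminf) simp
    also have "\<dots> \<le> liminf (\<lambda>k::nat. ennreal (e\<^sup>2))"
    proof (rule Liminf_mono, rule eventually_sequentiallyI[of K])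
      fix k assume "K \<le> k"
      have "(\<integral>\<^sup>+x. ennreal ((cmod (u n x - u (r k) x))\<^sup>2) \<partial>M) = ennreal ((L2_norm M (\<lambda>x. u n x - u (r k) x))\<^sup>2)"
        unfolding L2_norm_sq
        by (intro nn_integral_eq_integral L2_sq_integrable L2_diff u) auto
      also have "\<dots> \<le> ennreal (e\<^sup>2)"
        using that[OF \<open>K \<le> k\<close>] by (intro ennreal_leI power_mono) auto
      finally show "(\<integral>\<^sup>+x. ennreal ((cmod (u n x - u (r k) x))\<^sup>2) \<partial>M) \<le> ennreal (e\<^sup>2)" .
    qed
    also have "\<dots> = ennreal (e\<^sup>2)" by (simp add: Liminf_const)
    finally show ?thesis .
  qed
  have bound: "(\<lambda>x. u n x - f x) \<in> L2 M \<and> L2_norm M (\<lambda>x. u n x - f x) \<le> e"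
    if e: "e \<ge> 0" and le: "\<And>k. k \<ge> K \<Longrightarrow> L2_norm M (\<lambda>x. u n x - u (r k) x) \<le> e" for n K e
  proof -
    have le': "(\<integral>\<^sup>+x. ennreal ((cmod (u n x - f x))\<^sup>2) \<partial>M) \<le> ennreal (e\<^sup>2)"
      by (rule fatou[OF le])
    have int: "integrable M (\<lambda>x. (cmod (u n x - f x))\<^sup>2)"
      by (rule integrableI_bounded) (auto simp: order_le_less_trans[OF le'])
    then have mem: "(\<lambda>x. u n x - f x) \<in> L2 M" by (simp add: L2_def)
    have "ennreal ((L2_norm M (\<lambda>x. u n x - f x))\<^sup>2) \<le> ennreal (e\<^sup>2)"
      unfolding L2_norm_sq using le' int by (subst nn_integral_eq_integral[symmetric]) auto
    then have "(L2_norm M (\<lambda>x. u n x - f x))\<^sup>2 \<le> e\<^sup>2" by simp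
    then show ?thesis using mem power2_le_imp_le[OF _ e] by blast
  qed
  have dist: "(\<lambda>x. u n x - f x) \<in> L2 M \<and> L2_norm M (\<lambda>x. u n x - f x) \<le> (1/4) ^ k" if "n \<ge> N k" for n k
  proof (rule bound[where K = "N k"])
    fix i assume "N k \<le> i"
    then show "L2_norm M (\<lambda>x. u n x - u (r i) x) \<le> (1/4) ^ k"
      using N[of k n "r i"] that rk[of i] by simp
  qed simp
  show ?thesis
  proof (rule that)
    show "f \<in> L2 M"
      using L2_diff[OF u[of "N 0"] conjunct1[OF dist[of 0 "N 0"]]] by simp
    show "(\<lambda>n. L2_norm M (\<lambda>x. u n x - f x)) \<longlonglongrightarrow> 0"
    proof (rule LIMSEQ_I)
      fix e :: real assume "e > 0"
      then obtain k where "(1/4 :: real) ^ k < e" using real_arch_pow_inv[of e "1/4"] by auto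
      then have "\<forall>n\<ge>N k. norm (L2_norm M (\<lambda>x. u n x - f x) - 0) < e"
        using dist[of k] by (auto intro: order_le_less_trans)
      then show "\<exists>no. \<forall>n\<ge>no. norm (L2_norm M (\<lambda>x. u n x - f x) - 0) < e" ..
    qed
  qed
qed

lemma closed_subspaceD:
  assumes "closed_subspace M S"
  shows "f \<in> S \<Longrightarrow> f \<in> L2 M"
    and "(\<lambda>x. 0) \<in> S"
    and "f \<in> S \<Longrightarrow> g \<in> S \<Longrightarrow> (\<lambda>x. f x + g x) \<in> S"
    and "f \<in> S \<Longrightarrow> (\<lambda>x. c * f x) \<in> S"
    and "(\<And>n. u n \<in> S) \<Longrightarrow> f \<in> L2 M \<Longrightarrow> (\<lambda>n. L2_norm M (\<lambda>x. u n x - f x)) \<longlonglongrightarrow> 0 \<Longrightarrow> f \<in> S"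
  using assms unfolding closed_subspace_def by blast+

lemma closed_subspace_diff:
  assumes "closed_subspace M S" "f \<in> S" "g \<in> S"
  shows "(\<lambda>x. f x - g x) \<in> S"
  using closed_subspaceD(3)[OF assms(1,2) closed_subspaceD(4)[OF assms(1,3), of "-1"]] by simp

lemma closed_subspace_sum:
  assumes "closed_subspace M S" "\<And>i. i \<in> I \<Longrightarrow> f i \<in> S"
  shows "(\<lambda>x. \<Sum>i\<in>I. f i x) \<in> S"
  using assms(2)
proof (induction I rule: infinite_finite_induct)
  case (insert i I)
  then show ?case using closed_subspaceD(3)[OF assms(1), of "f i" "\<lambda>x. \<Sum>i\<in>I. f i x"] by simp
qed (simp_all add: closed_subspaceD(2)[OF assms(1)])

text \<open>
  A closed subspace contains with a function all its representatives: a constant sequence converges in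
  norm to each of them.
\<close>

lemma closed_subspace_cong_AE:
  assumes S: "closed_subspace M S" and f: "f \<in> S" and g: "g \<in> L2 M"
    and ae: "AE x in M. f x = g x"
  shows "g \<in> S"
proof (rule closed_subspaceD(5)[OF S, where u = "\<lambda>_. f"])
  have "L2_norm M (\<lambda>x. f x - g x) = 0"
    using ae by (subst L2_norm_eq_0_iff[OF L2_diff[OF closed_subspaceD(1)[OF S f] g]])
      (auto elim: eventually_mono)
  then show "(\<lambda>n. L2_norm M (\<lambda>x. f x - g x)) \<longlonglongrightarrow> 0" by simp
qed (use f g in auto)

lemma closed_subspace_L2: "closed_subspace M (L2 M)"
  unfolding closed_subspace_def by (auto intro: L2_add L2_scale)

lemma closed_subspace_Inter:
  assumes "\<S> \<noteq> {}" "\<And>S. S \<in> \<S> \<Longrightarrow> closed_subspace M S"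
  shows "closed_subspace M (\<Inter>\<S>)"
  unfolding closed_subspace_def
proof (intro conjI ballI allI impI InterI; (elim conjE)?)
  show "\<Inter>\<S> \<subseteq> L2 M" using assms closed_subspaceD(1) by blast
  show "f \<in> S" if "\<forall>n. u n \<in> \<Inter>\<S>" "f \<in> L2 M" "(\<lambda>n. L2_norm M (\<lambda>x. u n x - f x)) \<longlonglongrightarrow> 0"
    "S \<in> \<S>" for u f S
    using that by (intro closed_subspaceD(5)[OF assms(2), of S u f]) auto
qed (use assms(2) closed_subspaceD in blast)+

lemma closed_subspace_orthogonal:
  assumes S: "closed_subspace M S" and h: "h \<in> L2 M"
  shows "closed_subspace M {f \<in> S. L2_inner M f h = 0}"
  unfolding closed_subspace_def
proof (intro conjI ballI allI impI; (elim conjE)?)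
  note D = closed_subspaceD[OF S]
  show "{f \<in> S. L2_inner M f h = 0} \<subseteq> L2 M" using D(1) by blast
  show "(\<lambda>x. 0) \<in> {f \<in> S. L2_inner M f h = 0}" using D(2) by simp
  show "(\<lambda>x. f x + g x) \<in> {f \<in> S. L2_inner M f h = 0}"
    if "f \<in> {f \<in> S. L2_inner M f h = 0}" "g \<in> {f \<in> S. L2_inner M f h = 0}" for f g
    using that D(1,3) h by (simp add: L2_inner_add_left)
  show "(\<lambda>x. c * f x) \<in> {f \<in> S. L2_inner M f h = 0}" if "f \<in> {f \<in> S. L2_inner M f h = 0}" for c f
    using that D(4) by (simp add: L2_inner_scale_left)
  show "f \<in> {f \<in> S. L2_inner M f h = 0}"
    if u: "\<forall>n. u n \<in> {f \<in> S. L2_inner M f h = 0}" and f: "f \<in> L2 M"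
      and lim: "(\<lambda>n. L2_norm M (\<lambda>x. u n x - f x)) \<longlonglongrightarrow> 0" for u f
  proof -
    have "(\<lambda>n. L2_inner M (u n) h) \<longlonglongrightarrow> L2_inner M f h"
      using u D(1) by (intro L2_inner_tendsto_left f h lim) auto
    then have "L2_inner M f h = 0" using u by (simp add: LIMSEQ_const_iff)
    moreover have "f \<in> S" using u by (intro D(5)[OF _ f lim]) auto
    ultimately show ?thesis by simp
  qed
qed

lemma closed_subspace_orthogonal_set:
  assumes S: "closed_subspace M S" and H: "H \<subseteq> L2 M"
  shows "closed_subspace M {f \<in> S. \<forall>h\<in>H. L2_inner M f h = 0}"
proof (cases "H = {}")
  case False
  then have "{f \<in> S. \<forall>h\<in>H. L2_inner M f h = 0} = \<Inter> ((\<lambda>h. {f \<in> S. L2_inner M f h = 0}) ` H)"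
    by auto
  moreover have "closed_subspace M (\<Inter> ((\<lambda>h. {f \<in> S. L2_inner M f h = 0}) ` H))"
    using False H by (intro closed_subspace_Inter) (auto intro!: closed_subspace_orthogonal[OF S])
  ultimately show ?thesis by simp
qed (use S in simp)

text \<open>
  A sequence in \<open>S\<close> whose distances to \<open>f\<close> tend to the infimum is a Cauchy sequence by the parallelogram law,
  and its limit is at minimal distance; minimality in every direction of \<open>S\<close> means orthogonality.
\<close>

lemma L2_projection_exists:
  assumes S: "closed_subspace M S" and f: "f \<in> L2 M"
  obtains g where "g \<in> S" "\<And>h. h \<in> S \<Longrightarrow> L2_inner M (\<lambda>x. f x - g x) h = 0"
proof -
  note D = closed_subspaceD[OF S]
  define \<delta> where "\<delta> = Inf ((\<lambda>g. (L2_norm M (\<lambda>x. f x - g x))\<^sup>2) ` S)"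
  have bdd: "bdd_below ((\<lambda>g. (L2_norm M (\<lambda>x. f x - g x))\<^sup>2) ` S)"
    by (rule bdd_belowI[of _ 0]) auto
  have \<delta>_le: "\<delta> \<le> (L2_norm M (\<lambda>x. f x - g x))\<^sup>2" if "g \<in> S" for g
    unfolding \<delta>_def using that by (intro cInf_lower bdd) auto
  have "\<exists>g\<in>S. (L2_norm M (\<lambda>x. f x - g x))\<^sup>2 < \<delta> + 1 / real (Suc n)" for n
    using cInf_less_iff[OF _ bdd, of "\<delta> + 1 / real (Suc n)"] D(2) unfolding \<delta>_def[symmetric] by auto
  then obtain u where u: "\<And>n. u n \<in> S" "\<And>n. (L2_norm M (\<lambda>x. f x - u n x))\<^sup>2 < \<delta> + 1 / real (Suc n)"
    by metis
  \<comment> \<open>The parallelogram law, with the midpoint of two elements of \<open>S\<close> as competitor.\<close>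
  have par: "(L2_norm M (\<lambda>x. u m x - u n x))\<^sup>2 \<le> 2 / real (Suc m) + 2 / real (Suc n)" for m n
  proof -
    define a where "a = (\<lambda>x. f x - u m x)"
    define b where "b = (\<lambda>x. f x - u n x)"
    have ab: "a \<in> L2 M" "b \<in> L2 M" unfolding a_def b_def using f D(1)[OF u(1)] by (auto intro: L2_diff)
    have "(\<lambda>x. (1/2) * (u m x + u n x)) \<in> S" using u(1) D by blast
    from \<delta>_le[OF this] have "\<delta> \<le> (L2_norm M (\<lambda>x. (1/2) * (a x + b x)))\<^sup>2"
      by (simp add: a_def b_def field_simps)
    also have "\<dots> = (L2_norm M (\<lambda>x. a x + b x))\<^sup>2 / 4"
      unfolding L2_norm_scale by (simp add: power_mult_distrib power2_eq_square)
    finally have "4 * \<delta> \<le> (L2_norm M (\<lambda>x. a x + b x))\<^sup>2" by simp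
    moreover have "(L2_norm M (\<lambda>x. b x - a x))\<^sup>2 + (L2_norm M (\<lambda>x. a x + b x))\<^sup>2
        = 2 * (L2_norm M a)\<^sup>2 + 2 * (L2_norm M b)\<^sup>2"
      using L2_norm_sq_add[OF ab] L2_norm_sq_diff[OF ab]
      by (simp add: L2_norm_minus_commute[of M b a])
    moreover have "(\<lambda>x. b x - a x) = (\<lambda>x. u m x - u n x)" by (auto simp: a_def b_def)
    ultimately show ?thesis using u(2)[of m] u(2)[of n] by (simp add: a_def b_def)
  qed
  obtain g where g: "g \<in> L2 M" and lim: "(\<lambda>n. L2_norm M (\<lambda>x. u n x - g x)) \<longlonglongrightarrow> 0"
  proof (rule L2_complete[of u M])
    show "u n \<in> L2 M" for n using u(1) D(1) by blast
    show "\<exists>N. \<forall>m\<ge>N. \<forall>n\<ge>N. L2_norm M (\<lambda>x. u m x - u n x) < e" if e: "e > 0" for e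
    proof -
      obtain N :: nat where N: "4 / e\<^sup>2 < N" using reals_Archimedean2 by blast
      have "L2_norm M (\<lambda>x. u m x - u n x) < e" if "m \<ge> N" "n \<ge> N" for m n
      proof (rule power2_less_imp_less)
        have "0 < real N" using N e by (smt (verit) divide_pos_pos zero_less_power)
        then have "2 / real (Suc m) \<le> 2 / real N" "2 / real (Suc n) \<le> 2 / real N"
          using that by (auto intro!: divide_left_mono)
        moreover have "4 / real N < e\<^sup>2" using N e \<open>0 < real N\<close> by (simp add: field_simps)
        ultimately show "(L2_norm M (\<lambda>x. u m x - u n x))\<^sup>2 < e\<^sup>2" using par[of m n] by simp
      qed (use e in simp)
      then show ?thesis by blast
    qed
  qed blast
  have gS: "g \<in> S" by (rule D(5)[OF u(1) g lim])
  have min: "(L2_norm M (\<lambda>x. f x - g x))\<^sup>2 \<le> \<delta>"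
  proof (rule LIMSEQ_le)
    let ?v = "\<lambda>n. sqrt (\<delta> + 1 / real (Suc n)) + L2_norm M (\<lambda>x. u n x - g x)"
    show "(\<lambda>n. (L2_norm M (\<lambda>x. f x - g x))\<^sup>2) \<longlonglongrightarrow> (L2_norm M (\<lambda>x. f x - g x))\<^sup>2" by simp
    have "?v \<longlonglongrightarrow> sqrt (\<delta> + 0) + 0"
      by (intro tendsto_intros lim LIMSEQ_Suc[OF lim_1_over_n])
    then have "(\<lambda>n. (?v n)\<^sup>2) \<longlonglongrightarrow> (sqrt (\<delta> + 0) + 0)\<^sup>2" by (intro tendsto_power)
    moreover have "0 \<le> \<delta>" unfolding \<delta>_def using D(2) by (intro cInf_greatest) auto
    ultimately show "(\<lambda>n. (?v n)\<^sup>2) \<longlonglongrightarrow> \<delta>" by simp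
    show "\<exists>N. \<forall>n\<ge>N. (L2_norm M (\<lambda>x. f x - g x))\<^sup>2 \<le> (?v n)\<^sup>2"
    proof (intro exI allI impI power_mono)
      fix n
      have "L2_norm M (\<lambda>x. f x - u n x) \<le> sqrt (\<delta> + 1 / real (Suc n))"
        using u(2)[of n] by (intro real_le_rsqrt) simp
      then show "L2_norm M (\<lambda>x. f x - g x) \<le> ?v n"
        using L2_norm_triangle_diff[OF f D(1)[OF u(1)] g, of n] by simp
    qed simp
  qed
  show ?thesis
  proof (rule that[OF gS])
    fix h assume h: "h \<in> S"
    define r where "r = (\<lambda>x. f x - g x)"
    define i where "i = L2_inner M r h"
    define H where "H = (L2_norm M h)\<^sup>2"
    define t where "t = 1 / (H + 1)"
    have H: "0 \<le> H" by (simp add: H_def)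
    have rL: "r \<in> L2 M" unfolding r_def using f g by (rule L2_diff)
    have hL: "h \<in> L2 M" using h D(1) by blast
    \<comment> \<open>Moving \<open>g\<close> in the direction of \<open>h\<close> does not decrease the distance to \<open>f\<close>.\<close>
    \<comment> \<open>The step \<open>t i\<close> with \<open>t < 2 / H\<close> would decrease it strictly if \<open>i\<close> were not zero.\<close>
    have "(\<lambda>x. g x + (of_real t * i) * h x) \<in> S" using gS h D by blast
    from order_trans[OF min \<delta>_le[OF this]]
    have "(L2_norm M r)\<^sup>2 \<le> (L2_norm M (\<lambda>x. r x - (of_real t * i) * h x))\<^sup>2"
      by (simp only: r_def diff_diff_eq)
    also have "\<dots> = (L2_norm M r)\<^sup>2 - 2 * Re (cnj (of_real t * i) * i) + (cmod (of_real t * i))\<^sup>2 * H"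
      using rL hL by (simp add: L2_norm_sq_diff L2_scale L2_inner_scale_right L2_norm_scale
          power_mult_distrib i_def H_def)
    also have "cnj (of_real t * i) * i = of_real (t * (cmod i)\<^sup>2)"
      using complex_norm_square[of i] by (simp add: mult_ac)
    also have "(cmod (of_real t * i))\<^sup>2 * H = t * (cmod i)\<^sup>2 * (t * H)"
      by (simp add: norm_mult power2_eq_square)
    finally have "t * (cmod i)\<^sup>2 * (2 - t * H) \<le> 0" by (simp add: algebra_simps)
    moreover have "t * H < 2" using H unfolding t_def by (simp add: field_simps)
    moreover have "t > 0" using H unfolding t_def by simp
    ultimately have "(cmod i)\<^sup>2 \<le> 0" by (simp add: mult_le_0_iff)
    then show "L2_inner M (\<lambda>x. f x - g x) h = 0" by (simp add: i_def r_def)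
  qed
qed

section \<open>Closed spans and Parseval's identity\<close>

definition closed_span :: "'a measure \<Rightarrow> (nat \<Rightarrow> 'a \<Rightarrow> complex) \<Rightarrow> ('a \<Rightarrow> complex) set" where
  "closed_span M b = {f \<in> L2 M. \<forall>e>0. \<exists>N a. L2_norm M (\<lambda>x. f x - (\<Sum>n<N. a n * b n x)) < e}"

lemma closed_span_approx:
  assumes "f \<in> closed_span M b" "e > 0"
  obtains N a where "L2_norm M (\<lambda>x. f x - (\<Sum>n<N. a n * b n x)) < e"
  using assms unfolding closed_span_def by blast

lemma closed_subspace_closed_span:
  assumes b: "\<And>n. b n \<in> L2 M"
  shows "closed_subspace M (closed_span M b)"
  unfolding closed_subspace_def
proof (intro conjI ballI allI impI; (elim conjE)?)
  have comb: "(\<lambda>x. \<Sum>n<N. a n * b n x) \<in> L2 M" for N a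
    by (intro L2_sum L2_scale b)
  show "closed_span M b \<subseteq> L2 M" by (auto simp: closed_span_def)
  show "(\<lambda>x. 0) \<in> closed_span M b"
    unfolding closed_span_def by (auto intro!: exI[of _ 0] simp: L2_norm_def)
  show "(\<lambda>x. f x + g x) \<in> closed_span M b"
    if f: "f \<in> closed_span M b" and g: "g \<in> closed_span M b" for f g
    unfolding closed_span_def
  proof (safe)
    have fg: "f \<in> L2 M" "g \<in> L2 M" using f g by (auto simp: closed_span_def)
    then show "(\<lambda>x. f x + g x) \<in> L2 M" by (rule L2_add)
    fix e :: real assume "e > 0"
    then have "e / 2 > 0" by simp
    obtain N a where N1: "L2_norm M (\<lambda>x. f x - (\<Sum>n<N. a n * b n x)) < e / 2"
      using closed_span_approx[OF f \<open>e / 2 > 0\<close>] .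
    obtain N' a' where N2: "L2_norm M (\<lambda>x. g x - (\<Sum>n<N'. a' n * b n x)) < e / 2"
      using closed_span_approx[OF g \<open>e / 2 > 0\<close>] .
    let ?a = "\<lambda>n. (if n < N then a n else 0) + (if n < N' then a' n else 0)"
    have "(\<Sum>n<max N N'. ?a n * b n x) = (\<Sum>n<N. a n * b n x) + (\<Sum>n<N'. a' n * b n x)" for x
    proof -
      have ext: "(\<Sum>n<max N N'. (if n < K then c n else 0) * b n x) = (\<Sum>n<K. c n * b n x)"
        if "K \<le> max N N'" for K and c :: "nat \<Rightarrow> complex"
        by (rule sum.mono_neutral_cong_right) (use that in auto)
      show ?thesis by (simp only: distrib_right sum.distrib ext max.cobounded1 max.cobounded2)
    qed
    then have "L2_norm M (\<lambda>x. f x + g x - (\<Sum>n<max N N'. ?a n * b n x))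
        = L2_norm M (\<lambda>x. (f x - (\<Sum>n<N. a n * b n x)) + (g x - (\<Sum>n<N'. a' n * b n x)))"
      by (simp add: algebra_simps)
    also have "\<dots> < e"
      using L2_norm_triangle[OF L2_diff[OF fg(1) comb[where N = N and a = a]] L2_diff[OF fg(2) comb[where N = N' and a = a']]] N1 N2 by simp
    finally show "\<exists>N a. L2_norm M (\<lambda>x. f x + g x - (\<Sum>n<N. a n * b n x)) < e"
      by (intro exI[of _ "max N N'"] exI[of _ ?a])
  qed
  show "(\<lambda>x. c * f x) \<in> closed_span M b" if f: "f \<in> closed_span M b" for c f
    unfolding closed_span_def
  proof (safe)
    show "(\<lambda>x. c * f x) \<in> L2 M" using f by (auto simp: closed_span_def intro: L2_scale)
    fix e :: real assume e: "e > 0"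
    then have pos: "e / (cmod c + 1) > 0" by (intro divide_pos_pos add_nonneg_pos) auto
    obtain N a where N: "L2_norm M (\<lambda>x. f x - (\<Sum>n<N. a n * b n x)) < e / (cmod c + 1)"
      using closed_span_approx[OF f pos] .
    have "L2_norm M (\<lambda>x. c * f x - (\<Sum>n<N. (c * a n) * b n x)) = L2_norm M (\<lambda>x. c * (f x - (\<Sum>n<N. a n * b n x)))"
      by (simp add: sum_distrib_left right_diff_distrib mult.assoc)
    also have "\<dots> \<le> cmod c * (e / (cmod c + 1))"
      unfolding L2_norm_scale using N by (intro mult_left_mono) auto
    also have "\<dots> < e" using e add_nonneg_pos[OF norm_ge_zero[of c] zero_less_one] by (simp add: field_simps)
    finally show "\<exists>N a. L2_norm M (\<lambda>x. c * f x - (\<Sum>n<N. a n * b n x)) < e" 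
      by (intro exI[of _ N] exI[of _ "\<lambda>n. c * a n"])
  qed
  show "f \<in> closed_span M b"
    if u: "\<forall>n. u n \<in> closed_span M b" and f: "f \<in> L2 M"
      and lim: "(\<lambda>n. L2_norm M (\<lambda>x. u n x - f x)) \<longlonglongrightarrow> 0" for u f
    unfolding closed_span_def
  proof (safe)
    fix e :: real assume "e > 0"
    then have "e / 2 > 0" by simp
    from order_tendstoD(2)[OF lim this] obtain k where k: "L2_norm M (\<lambda>x. u k x - f x) < e / 2"
      by (auto simp: eventually_sequentially)
    obtain N a where N: "L2_norm M (\<lambda>x. u k x - (\<Sum>n<N. a n * b n x)) < e / 2"
      using closed_span_approx[OF u[rule_format] \<open>e / 2 > 0\<close>] .
    have "u k \<in> L2 M" using u by (auto simp: closed_span_def)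
    from L2_norm_triangle_diff[OF f this comb[where N = N and a = a]]
    have "L2_norm M (\<lambda>x. f x - (\<Sum>n<N. a n * b n x)) < e"
      using k N by (simp add: L2_norm_minus_commute[of M f])
    then show "\<exists>N a. L2_norm M (\<lambda>x. f x - (\<Sum>n<N. a n * b n x)) < e"
      by (intro exI[of _ N] exI[of _ a])
  qed (rule f)
qed

lemma closed_span_contains:
  assumes b: "\<And>n. b n \<in> L2 M"
  shows "b m \<in> closed_span M b"
  unfolding closed_span_def
proof (safe)
  fix e :: real assume e: "e > 0"
  have "(\<Sum>n<Suc m. (if n = m then 1 else 0) * b n x) = b m x" for x
    by (simp add: if_distrib[of "\<lambda>t. t * _"] cong: if_cong)
  then have "L2_norm M (\<lambda>x. b m x - (\<Sum>n<Suc m. (if n = m then 1 else 0) * b n x)) < e"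
    using e by (simp add: L2_norm_def)
  then show "\<exists>N a. L2_norm M (\<lambda>x. b m x - (\<Sum>n<N. a n * b n x)) < e"
    by (intro exI[of _ "Suc m"] exI[of _ "\<lambda>n. if n = m then 1 else 0"])
qed (rule b)

text \<open>
  The induction principle for closed spans: a property that defines a closed subspace need only be
  checked on the spanning sequence.
\<close>

lemma closed_span_least:
  assumes S: "closed_subspace M S" and b: "\<And>n. b n \<in> S"
  shows "closed_span M b \<subseteq> S"
proof
  fix f assume f: "f \<in> closed_span M b"
  have "\<exists>N a. L2_norm M (\<lambda>x. f x - (\<Sum>n<N. a n * b n x)) < 1 / real (Suc k)" for k
    using f unfolding closed_span_def by simp
  then obtain N a where Na: "\<And>k. L2_norm M (\<lambda>x. f x - (\<Sum>n<N k. a k n * b n x)) < 1 / real (Suc k)"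
    by metis
  show "f \<in> S"
  proof (rule closed_subspaceD(5)[OF S])
    show "(\<lambda>x. \<Sum>n<N k. a k n * b n x) \<in> S" for k
      by (intro closed_subspace_sum[OF S] closed_subspaceD(4)[OF S] b)
    show "f \<in> L2 M" using f by (simp add: closed_span_def)
    show "(\<lambda>k. L2_norm M (\<lambda>x. (\<Sum>n<N k. a k n * b n x) - f x)) \<longlonglongrightarrow> 0"
    proof (rule Lim_null_comparison[OF _ LIMSEQ_Suc[OF lim_1_over_n]])
      show "\<forall>\<^sub>F k in sequentially. norm (L2_norm M (\<lambda>x. (\<Sum>n<N k. a k n * b n x) - f x)) \<le> 1 / real (Suc k)"
        using less_imp_le[OF Na] by (intro always_eventually) (simp add: L2_norm_minus_commute[of M _ f])
    qed
  qed
qed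

text \<open>
  For an orthonormal sequence, the squared distance from \<open>f\<close> to a combination with coefficients \<open>a\<^sub>n\<close> is
  \<open>\<parallel>f\<parallel>\<^sup>2 - \<Sum>|c\<^sub>n|\<^sup>2 + \<Sum>|a\<^sub>n - c\<^sub>n|\<^sup>2\<close>, where \<open>c\<^sub>n\<close> are the coefficients of \<open>f\<close>. Hence \<open>\<parallel>f\<parallel>\<^sup>2 - \<Sum>|c\<^sub>n|\<^sup>2\<close> is
  at most any squared distance, and these come arbitrarily close to zero.
\<close>

lemma L2_Parseval:
  assumes e: "\<And>n. e n \<in> L2 M"
    and orth: "\<And>m n. L2_inner M (e m) (e n) = (if m = n then 1 else 0)"
    and f: "f \<in> closed_span M e"
  shows "(\<lambda>n. (cmod (L2_inner M f (e n)))\<^sup>2) sums (L2_norm M f)\<^sup>2"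
proof -
  have fL: "f \<in> L2 M" using f by (simp add: closed_span_def)
  define c where "c n = L2_inner M f (e n)" for n
  have dist: "(L2_norm M (\<lambda>x. f x - (\<Sum>n<N. a n * e n x)))\<^sup>2
      = (L2_norm M f)\<^sup>2 - (\<Sum>n<N. (cmod (c n))\<^sup>2) + (\<Sum>n<N. (cmod (a n - c n))\<^sup>2)" for N a
  proof -
    define u where "u = (\<lambda>x. \<Sum>n<N. a n * e n x)"
    have u: "u \<in> L2 M" unfolding u_def by (intro L2_sum L2_scale e)
    have fu: "L2_inner M f u = (\<Sum>n<N. cnj (a n) * c n)"
      unfolding u_def c_def by (simp add: L2_inner_sum_right L2_inner_scale_right L2_scale e fL)
    have "L2_inner M u u = (\<Sum>n<N. a n * L2_inner M (e n) u)"
      by (subst u_def) (simp add: L2_inner_sum_left L2_inner_scale_left L2_scale e u)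
    also have "\<dots> = (\<Sum>n<N. a n * cnj (a n))"
      unfolding u_def by (intro sum.cong refl)
        (simp add: L2_inner_sum_right L2_inner_scale_right L2_scale e orth if_distrib cong: if_cong)
    also have "\<dots> = of_real (\<Sum>n<N. (cmod (a n))\<^sup>2)"
      by (simp only: complex_norm_square of_real_sum)
    finally have uu: "(L2_norm M u)\<^sup>2 = (\<Sum>n<N. (cmod (a n))\<^sup>2)"
      unfolding L2_inner_self of_real_eq_iff .
    have "(cmod (a n - c n))\<^sup>2 = (cmod (a n))\<^sup>2 - 2 * Re (cnj (a n) * c n) + (cmod (c n))\<^sup>2" for n
      by (simp add: cmod_power2) (simp add: power2_eq_square algebra_simps)
    then show ?thesis
      unfolding L2_norm_sq_diff[OF fL u, unfolded u_def] fu[unfolded u_def] uu[unfolded u_def]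
      by (simp add: sum.distrib sum_subtractf sum_distrib_left)
  qed
  have le: "(\<Sum>n<N. (cmod (c n))\<^sup>2) \<le> (L2_norm M f)\<^sup>2" for N
    using dist[where N = N and a = c] zero_le_power2[of "L2_norm M (\<lambda>x. f x - (\<Sum>n<N. c n * e n x))"] by simp
  have "(\<lambda>N. \<Sum>n<N. (cmod (c n))\<^sup>2) \<longlonglongrightarrow> (L2_norm M f)\<^sup>2"
  proof (rule LIMSEQ_I)
    fix r :: real assume r: "r > 0"
    then obtain N a where N: "L2_norm M (\<lambda>x. f x - (\<Sum>n<N. a n * e n x)) < sqrt r"
      using f unfolding closed_span_def by (auto dest!: spec[of _ "sqrt r"])
    have "(L2_norm M (\<lambda>x. f x - (\<Sum>n<N. a n * e n x)))\<^sup>2 < (sqrt r)\<^sup>2"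
      using N by (intro power_strict_mono) auto
    moreover have "0 \<le> (\<Sum>n<N. (cmod (a n - c n))\<^sup>2)" by (intro sum_nonneg) auto
    ultimately have *: "(L2_norm M f)\<^sup>2 - r < (\<Sum>n<N. (cmod (c n))\<^sup>2)" using dist[where N = N and a = a] r by simp
    have "norm ((\<Sum>n<k. (cmod (c n))\<^sup>2) - (L2_norm M f)\<^sup>2) < r" if "k \<ge> N" for k
    proof -
      have "(\<Sum>n<N. (cmod (c n))\<^sup>2) \<le> (\<Sum>n<k. (cmod (c n))\<^sup>2)"
        using that by (intro sum_mono2) auto
      then show ?thesis using * le[of k] by simp
    qed
    then show "\<exists>N. \<forall>k\<ge>N. norm ((\<Sum>n<k. (cmod (c n))\<^sup>2) - (L2_norm M f)\<^sup>2) < r" by blast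
  qed
  then show ?thesis by (simp add: sums_def c_def)
qed

section \<open>Uniqueness of Fourier series on the circle\<close>

lemma cnj_powi_circle: "cmod w = 1 \<Longrightarrow> cnj (w powi n) = w powi (- n)"
  for w :: complex
proof -
  assume w: "cmod w = 1"
  then have "cnj w = inverse w"
    by (metis complex_norm_square inverse_unique of_real_1 power_one)
  then show ?thesis by (simp add: power_int_minus power_int_inverse[symmetric])
qed

lemma integrable_circle_bounded_mult:
  assumes f: "integrable circle f" and [measurable]: "g \<in> borel_measurable borel"
    and "\<And>w. cmod w = 1 \<Longrightarrow> cmod (g w) \<le> K"
  shows "integrable circle (\<lambda>w. f w * g w)"
proof (rule Bochner_Integration.integrable_bound)
  show "integrable circle (\<lambda>w. complex_of_real K * f w)" using f by simp
  show "(\<lambda>w. f w * g w) \<in> borel_measurable circle"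
    using borel_measurable_integrable[OF f] by simp
  show "AE w in circle. norm (f w * g w) \<le> norm (complex_of_real K * f w)"
    using AE_circle
  proof eventually_elim
    case (elim w)
    then show ?case using assms(3)[of w] norm_ge_zero[of "g w"]
      by (simp add: norm_mult mult.commute[of "cmod (f w)"] mult_right_mono)
  qed
qed

lemma powi_measurable [measurable]: "(\<lambda>w::complex. w powi n) \<in> borel_measurable borel"
  unfolding power_int_def by measurable

text \<open>
  The integrable functions with vanishing Fourier coefficients form a module over the real polynomials in
  \<open>Re w\<close> and \<open>Im w\<close>, because multiplication by \<open>w\<close> or \<open>cnj w\<close> only shifts the coefficients. Stating this
  as closure under multiplication makes the case of products of polynomials immediate.
\<close>

lemma fourier_zero_mult_polynomial:
  assumes g: "real_polynomial_function g"
    and f: "integrable circle f" "\<And>n. fourier_circle f n = 0"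
  shows "integrable circle (\<lambda>w. f w * of_real (g w)) \<and> (\<forall>n. fourier_circle (\<lambda>w. f w * of_real (g w)) n = 0)"
  using g f
proof (induction arbitrary: f rule: real_polynomial_function.induct)
  case (linear h)
  note [measurable] = borel_measurable_integrable[OF linear.prems(1), unfolded measurable_cong_sets[OF sets_circle refl]]
  have hm: "h \<in> borel_measurable borel"
    using linear.hyps by (intro borel_measurable_continuous_onI linear_continuous_on)
  obtain K where K: "\<And>w. norm (h w) \<le> norm w * K"
    using bounded_linear.bounded[OF linear.hyps] by blast
  have int: "integrable circle (\<lambda>w. f w * of_real (h w))"
    by (rule integrable_circle_bounded_mult[OF linear.prems(1), where K = K])
      (use K[of w for w] hm in \<open>simp_all, metis mult_1\<close>)
  define \<gamma> where "\<gamma> = (complex_of_real (h 1) - \<i> * of_real (h \<i>)) / 2"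
  define \<delta> where "\<delta> = (complex_of_real (h 1) + \<i> * of_real (h \<i>)) / 2"
  \<comment> \<open>On the circle a real-linear function is a combination of \<open>w\<close> and \<open>1/w\<close>.\<close>
  have h_eq: "of_real (h w) = \<gamma> * w + \<delta> * cnj w" for w
  proof -
    interpret bounded_linear h by (rule linear.hyps)
    have "h w = h (Re w *\<^sub>R 1 + Im w *\<^sub>R \<i>)"
      by (intro arg_cong[where f = h]) (simp add: complex_eq_iff)
    also have "\<dots> = Re w * h 1 + Im w * h \<i>" by (simp only: add scaleR real_scaleR_def)
    finally show ?thesis by (simp add: \<gamma>_def \<delta>_def complex_eq_iff field_simps)
  qed
  have fint: "integrable circle (\<lambda>w. f w * cnj (w powi m))" for m
    by (rule integrable_circle_bounded_mult[OF linear.prems(1), where K = 1])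
      (auto simp: norm_power_int)
  have "fourier_circle (\<lambda>w. f w * of_real (h w)) n = 0" for n
  proof -
    have "fourier_circle (\<lambda>w. f w * of_real (h w)) n
        = (LINT w|circle. \<gamma> * (f w * cnj (w powi (n - 1))) + \<delta> * (f w * cnj (w powi (n + 1))))"
      unfolding fourier_circle_def L2_inner_def
    proof (rule integral_cong_AE)
      show "AE w in circle. f w * of_real (h w) * cnj (w powi n)
          = \<gamma> * (f w * cnj (w powi (n - 1))) + \<delta> * (f w * cnj (w powi (n + 1)))"
        using AE_circle
      proof eventually_elim
        case (elim w)
        then have "w \<noteq> 0" by auto
        moreover have "- (n - 1) = 1 + - n" "- (n + 1) = - 1 + - n" by simp_all
        ultimately have shift: "w * w powi - n = w powi - (n - 1)" "cnj w * w powi - n = w powi - (n + 1)"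
          using cnj_powi_circle[OF elim, of 1] power_int_add[of w 1 "- n"] power_int_add[of w "- 1" "- n"]
          by (simp_all only: power_int_1_right simp_thms)
        have "f w * of_real (h w) * cnj (w powi n)
            = \<gamma> * (f w * (w * w powi - n)) + \<delta> * (f w * (cnj w * w powi - n))"
          unfolding h_eq cnj_powi_circle[OF elim] by (simp only: algebra_simps)
        then show ?case by (simp only: shift cnj_powi_circle[OF elim])
      qed
    qed (use hm in measurable)
    also have "\<dots> = \<gamma> * fourier_circle f (n - 1) + \<delta> * fourier_circle f (n + 1)"
      unfolding fourier_circle_def L2_inner_def using fint by simp
    finally show ?thesis using linear.prems(2) by simp
  qed
  then show ?case using int by blast
next
  case (const c)
  have "fourier_circle (\<lambda>w. f w * of_real c) n = fourier_circle f n * of_real c" for n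
    unfolding fourier_circle_def L2_inner_def
    by (subst integral_mult_left_zero[symmetric]) (simp add: mult_ac)
  then show ?case using const by simp
next
  case (add g1 g2)
  have int: "integrable circle (\<lambda>w. (f w * of_real (g w)) * cnj (w powi n))"
    if "integrable circle (\<lambda>w. f w * of_real (g w))" for g and n
    by (rule integrable_circle_bounded_mult[OF that, where K = 1]) (auto simp: norm_power_int)
  note i1 = add.IH(1)[OF add.prems] and i2 = add.IH(2)[OF add.prems]
  have "fourier_circle (\<lambda>w. f w * of_real (g1 w + g2 w)) n
      = fourier_circle (\<lambda>w. f w * of_real (g1 w)) n + fourier_circle (\<lambda>w. f w * of_real (g2 w)) n" for n
    using Bochner_Integration.integral_add[OF int[OF conjunct1[OF i1]] int[OF conjunct1[OF i2]]]
    unfolding fourier_circle_def L2_inner_def by (simp only: of_real_add distrib_left distrib_right)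
  then show ?case using i1 i2 by (simp add: distrib_left)
next
  case (mult g1 g2)
  note i1 = mult.IH(1)[OF mult.prems]
  show ?case using mult.IH(2)[OF conjunct1[OF i1]] i1 by (simp add: mult.assoc)
qed

text \<open>
  By Stone--Weierstrass, \<open>g\<close> is a uniform limit on the circle of polynomials, against which \<open>f\<close> integrates to
  zero.
\<close>

lemma fourier_zero_integral_continuous:
  assumes f: "integrable circle f" "\<And>n. fourier_circle f n = 0"
    and g: "continuous_on UNIV (g :: complex \<Rightarrow> real)"
  shows "(LINT w|circle. f w * of_real (g w)) = 0"
proof -
  have [measurable]: "g \<in> borel_measurable borel" using g by (rule borel_measurable_continuous_onI)
  define F where "F = (LINT w|circle. cmod (f w))"
  have F: "0 \<le> F" unfolding F_def by simp
  have gc: "continuous_on (sphere 0 1) g" using g continuous_on_subset by blast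
  have "bounded (g ` sphere 0 1)"
    by (intro compact_imp_bounded compact_continuous_image gc compact_sphere)
  then obtain K where "\<forall>w\<in>sphere 0 1. norm (g w) \<le> K"
    unfolding bounded_iff by blast
  then have K: "\<And>w. cmod w = 1 \<Longrightarrow> \<bar>g w\<bar> \<le> K" by simp
  have fg: "integrable circle (\<lambda>w. f w * of_real (g w))"
    by (rule integrable_circle_bounded_mult[OF f(1), where K = K]) (use K in auto)
  have bound: "cmod (LINT w|circle. f w * of_real (g w)) \<le> e * F" if e: "e > 0" for e
  proof -
    obtain p where p: "real_polynomial_function p" "\<And>w. w \<in> sphere 0 1 \<Longrightarrow> \<bar>g w - p w\<bar> < e"
      using Stone_Weierstrass_real_polynomial_function[OF compact_sphere gc e] by blast
    note fp = fourier_zero_mult_polynomial[OF p(1) f]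
    have "(LINT w|circle. f w * of_real (p w)) = 0"
      using spec[OF conjunct2[OF fp], of 0] by (simp add: fourier_circle_def L2_inner_def)
    then have "(LINT w|circle. f w * of_real (g w)) = (LINT w|circle. f w * of_real (g w) - f w * of_real (p w))"
      using fg fp by simp
    also have "cmod \<dots> \<le> (LINT w|circle. cmod (f w * of_real (g w) - f w * of_real (p w)))"
      by (rule integral_norm_bound)
    also have "\<dots> \<le> (LINT w|circle. e * cmod (f w))"
    proof (rule integral_mono_AE)
      show "AE w in circle. cmod (f w * of_real (g w) - f w * of_real (p w)) \<le> e * cmod (f w)"
        using AE_circle
      proof eventually_elim
        case (elim w)
        have "cmod (f w * of_real (g w) - f w * of_real (p w)) = \<bar>g w - p w\<bar> * cmod (f w)"
          by (simp add: norm_mult mult.commute flip: right_diff_distrib of_real_diff)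
        also have "\<dots> \<le> e * cmod (f w)" using p(2)[of w] elim by (intro mult_right_mono) auto
        finally show ?case .
      qed
    qed (use fg fp f in auto)
    finally show ?thesis by (simp add: F_def)
  qed
  have "cmod (LINT w|circle. f w * of_real (g w)) \<le> 0"
  proof (rule field_le_epsilon)
    fix e :: real assume e: "e > 0"
    have "cmod (LINT w|circle. f w * of_real (g w)) \<le> e / (F + 1) * F"
      using e F by (intro bound divide_pos_pos) auto
    also have "\<dots> \<le> 0 + e" using e F by (simp add: field_simps)
    finally show "cmod (LINT w|circle. f w * of_real (g w)) \<le> 0 + e" .
  qed
  then show ?thesis by simp
qed

text \<open>
  The indicator of \<open>C\<close> is the pointwise limit of the continuous functions \<open>max 0 (1 - k d(w, C))\<close>, all bounded
  by 1.
\<close>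

lemma fourier_zero_integral_closed:
  assumes f: "integrable circle f" "\<And>n. fourier_circle f n = 0"
    and C: "closed C"
  shows "(LINT w:C|circle. f w) = 0"
proof (cases "C = {}")
  case False
  define g where "g k w = max 0 (1 - real k * infdist w C)" for k :: nat and w
  have g01: "0 \<le> g k w" "g k w \<le> 1" for k w
    unfolding g_def using infdist_nonneg[of w C] by auto
  have g_cont: "continuous_on UNIV (g k)" for k
    unfolding g_def by (intro continuous_intros)
  have [measurable]: "g k \<in> borel_measurable borel" for k
    using g_cont by (rule borel_measurable_continuous_onI)
  have [measurable]: "f \<in> borel_measurable borel"
    using borel_measurable_integrable[OF f(1)] by simp
  have [measurable]: "C \<in> sets borel" using C by simp
  have lim: "(\<lambda>k. g k w) \<longlonglongrightarrow> indicator C w" for w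
  proof (cases "w \<in> C")
    case True
    then show ?thesis by (simp add: g_def infdist_zero)
  next
    case w: False
    then have pos: "infdist w C > 0"
      using C False in_closed_iff_infdist_zero infdist_nonneg[of w C] by (metis less_eq_real_def)
    obtain N :: nat where N: "1 / infdist w C < N" using reals_Archimedean2 by blast
    have "g k w = 0" if "k \<ge> N" for k
    proof -
      have "1 < real N * infdist w C" using N pos by (simp add: field_simps)
      also have "\<dots> \<le> real k * infdist w C" using that pos by simp
      finally show ?thesis by (simp add: g_def)
    qed
    then have "\<forall>\<^sub>F k in sequentially. g k w = indicator C w"
      using w by (auto simp: eventually_sequentially)
    then show ?thesis by (rule tendsto_eventually)
  qed
  have "(\<lambda>k. LINT w|circle. f w * of_real (g k w)) \<longlonglongrightarrow> (LINT w|circle. f w * of_real (indicator C w))"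
  proof (rule integral_dominated_convergence)
    show "integrable circle (\<lambda>w. cmod (f w))" using f by simp
    show "AE w in circle. (\<lambda>k. f w * of_real (g k w)) \<longlonglongrightarrow> f w * of_real (indicator C w)"
      by (intro AE_I2 tendsto_intros lim)
    show "AE w in circle. norm (f w * of_real (g k w)) \<le> cmod (f w)" for k
      using g01 by (intro AE_I2) (simp add: norm_mult mult_left_le)
  qed measurable
  moreover have "(LINT w|circle. f w * of_real (g k w)) = 0" for k
    by (rule fourier_zero_integral_continuous[OF f g_cont])
  ultimately have "(LINT w|circle. f w * of_real (indicator C w)) = 0"
    by (simp add: LIMSEQ_const_iff)
  also have "(\<lambda>w. f w * of_real (indicator C w)) = (\<lambda>w. indicator C w *\<^sub>R f w)"
    by (simp add: scaleR_conv_of_real mult.commute)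
  finally show ?thesis by (simp add: set_lebesgue_integral_def)
qed (simp add: set_lebesgue_integral_def)

text \<open>
  The sets over which \<open>f\<close> integrates to zero form a Dynkin system containing the closed sets, hence all Borel
  sets.
\<close>

lemma fourier_circle_unique:
  assumes f: "integrable circle f" "\<And>n. fourier_circle f n = 0"
  shows "AE w in circle. f w = 0"
proof -
  interpret prob_space circle by (rule prob_space_circle)
  have int: "set_integrable circle A f" if "A \<in> sets borel" for A
    unfolding set_integrable_def using that f(1) by (intro integrable_mult_indicator) auto
  have borel: "sets borel = sigma_sets UNIV (Collect (closed :: complex set \<Rightarrow> bool))"
    by (simp add: borel_eq_closed)
  have stable: "Int_stable (Collect (closed :: complex set \<Rightarrow> bool))" by (auto simp: Int_stable_def)
  have "(LINT w:A|circle. f w) = 0" if "A \<in> sigma_sets UNIV (Collect closed)" for A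
    using stable subset_UNIV[of "Collect closed", folded Pow_UNIV] that
  proof (induction rule: sigma_sets_induct_disjoint)
    case (basic A)
    then show ?case using fourier_zero_integral_closed[OF f] by simp
  next
    case empty
    show ?case by (simp add: set_lebesgue_integral_def)
  next
    case (compl A)
    then have A: "A \<in> sets borel" by (simp add: borel)
    then have "(LINT w:A \<union> (UNIV - A)|circle. f w) = (LINT w:A|circle. f w) + (LINT w:UNIV - A|circle. f w)"
      by (intro set_integral_Un int) auto
    then show ?case
      using compl.IH fourier_zero_integral_closed[OF f closed_UNIV] by simp
  next
    case (union A)
    then have A: "A i \<in> sets borel" for i by (auto simp: borel)
    have "(LINT w:(\<Union>i. A i)|circle. f w) = (\<Sum>i. (LINT w:(A i)|circle. f w))"
      using A union.hyps(1)
      by (intro lebesgue_integral_countable_add int sets.countable_UN) (auto simp: disjoint_family_on_def)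
    then show ?case using union.IH by simp
  qed
  then show ?thesis
    by (intro density_zero f(1)) (simp add: borel)
qed

section \<open>Fourier coefficients on the torus and the diagonal space\<close>

definition torus_character :: "int \<Rightarrow> int \<Rightarrow> complex \<times> complex \<Rightarrow> complex" where
  "torus_character m n = (\<lambda>x. fst x powi m * snd x powi n)"

lemma fourier_torus_eq: "fourier_torus f m n = L2_inner torus f (torus_character m n)"
  by (simp add: fourier_torus_def torus_character_def case_prod_beta')

lemma torus_character_measurable [measurable]: "torus_character m n \<in> borel_measurable torus"
  unfolding torus_character_def by measurable

lemma torus_character_unimodular: "AE x in torus. cmod (torus_character m n x) = 1"
  using AE_torus by eventually_elim (simp add: torus_character_def norm_mult norm_power_int)

lemma torus_character_L2 [simp]: "torus_character m n \<in> L2 torus"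
  using L2_mult_unimodular[OF L2_const[OF prob_space_torus, of 1] torus_character_measurable
      torus_character_unimodular] by simp

lemma integral_torus_character:
  "(LINT x|torus. torus_character m n x) = (if m = 0 \<and> n = 0 then 1 else 0)"
proof -
  interpret prob_space circle by (rule prob_space_circle)
  interpret pair_prob_space circle circle ..
  have "integrable (circle \<Otimes>\<^sub>M circle) (\<lambda>(z, w). z powi m * w powi n)"
    using L2_integrable[OF prob_space_torus torus_character_L2[of m n]]
    by (simp add: torus_def torus_character_def case_prod_beta')
  from integral_snd[OF this]
  have "(LINT w|circle. LINT z|circle. z powi m * w powi n) = (LINT x|torus. torus_character m n x)"
    by (simp add: torus_def torus_character_def case_prod_beta')
  moreover have "(LINT w|circle. LINT z|circle. z powi m * w powi n)
      = (LINT w|circle. (LINT z|circle. z powi m) * w powi n)"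
    by (simp only: integral_mult_left_zero)
  ultimately have "(LINT x|torus. torus_character m n x) = (LINT z|circle. z powi m) * (LINT w|circle. w powi n)"
    by simp
  then show ?thesis by (simp only: integral_powi_circle) simp
qed

lemma torus_character_mult_cnj:
  "AE x in torus. torus_character a b x * cnj (torus_character c d x) = torus_character (a - c) (b - d) x"
  using AE_torus
proof eventually_elim
  case (elim x)
  then have "fst x \<noteq> 0" "snd x \<noteq> 0" by auto
  then show ?case using elim
    by (simp add: torus_character_def cnj_powi_circle power_int_add[of _ _ "- _", simplified] del: complex_cnj_power_int)
qed

lemma fourier_torus_character:
  "fourier_torus (torus_character a b) c d = (if a = c \<and> b = d then 1 else 0)"
proof -
  have "fourier_torus (torus_character a b) c d = (LINT x|torus. torus_character (a - c) (b - d) x)"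
    unfolding fourier_torus_eq L2_inner_def
    by (rule integral_cong_AE[OF _ _ torus_character_mult_cnj]) measurable
  then show ?thesis by (simp add: integral_torus_character)
qed

lemma fourier_torus_mult_character:
  assumes f: "f \<in> L2 torus"
  shows "fourier_torus (\<lambda>x. torus_character a b x * f x) c d = fourier_torus f (c - a) (d - b)"
proof -
  have [measurable]: "f \<in> borel_measurable torus" using f by measurable
  show ?thesis
    unfolding fourier_torus_eq L2_inner_def
  proof (rule integral_cong_AE)
    show "AE x in torus. torus_character a b x * f x * cnj (torus_character c d x)
        = f x * cnj (torus_character (c - a) (d - b) x)"
      using torus_character_mult_cnj[of a b c d] torus_character_mult_cnj[of 0 0 "c - a" "d - b"]
    proof eventually_elim
      case (elim x)
      have "torus_character a b x * f x * cnj (torus_character c d x)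
          = f x * (torus_character a b x * cnj (torus_character c d x))" by simp
      also have "\<dots> = f x * (torus_character 0 0 x * cnj (torus_character (c - a) (d - b) x))"
        unfolding elim by simp
      finally show ?case by (simp add: torus_character_def)
    qed
  qed measurable
qed

lemma diag_poly_eq: "diag_poly m = (\<lambda>x. \<Sum>i\<le>m. torus_character (int i) (int m - int i) x)"
proof (rule ext)
  fix x :: "complex \<times> complex"
  have "snd x ^ (m - i) = snd x powi (int m - int i)" if "i \<le> m" for i
    using that by (simp add: power_int_def nat_diff_distrib)
  then show "diag_poly m x = (\<Sum>i\<le>m. torus_character (int i) (int m - int i) x)"
    by (auto simp: diag_poly_def torus_character_def case_prod_beta' intro!: sum.cong)
qed

lemma diag_poly_L2 [simp]: "diag_poly m \<in> L2 torus"
  unfolding diag_poly_eq by (intro L2_sum torus_character_L2)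

lemma L2_inner_diag_poly:
  "f \<in> L2 torus \<Longrightarrow> L2_inner torus f (diag_poly m) = (\<Sum>i\<le>m. fourier_torus f (int i) (int m - int i))"
  unfolding diag_poly_eq fourier_torus_eq by (rule L2_inner_sum_right) auto

lemma fourier_torus_diag_poly:
  "fourier_torus (diag_poly m) a b = (if 0 \<le> a \<and> 0 \<le> b \<and> a + b = int m then 1 else 0)"
proof -
  have "fourier_torus (diag_poly m) a b = (\<Sum>i\<le>m. fourier_torus (torus_character (int i) (int m - int i)) a b)"
    unfolding diag_poly_eq fourier_torus_eq by (rule L2_inner_sum_left) auto
  also have "\<dots> = (\<Sum>i\<le>m. if i = nat a then (if 0 \<le> a \<and> 0 \<le> b \<and> a + b = int m then 1 else 0) else 0)"
    by (rule sum.cong) (auto simp: fourier_torus_character)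
  also have "\<dots> = (if 0 \<le> a \<and> 0 \<le> b \<and> a + b = int m then 1 else 0)"
    by auto
  finally show ?thesis .
qed

lemma closed_subspace_hardy_torus: "closed_subspace torus hardy_torus"
proof -
  have eq: "hardy_torus = \<Inter> ((\<lambda>(m, n). {f \<in> L2 torus. L2_inner torus f (torus_character m n) = 0}) ` {(m, n). m < 0 \<or> n < 0})"
    (is "_ = \<Inter> ?\<S>")
  proof
    show "hardy_torus \<subseteq> \<Inter> ?\<S>" unfolding hardy_torus_def fourier_torus_eq by blast
    have "{f \<in> L2 torus. L2_inner torus f (torus_character (-1) 0) = 0} \<in> ?\<S>" by force
    then have "\<Inter> ?\<S> \<subseteq> L2 torus" by blast
    then show "\<Inter> ?\<S> \<subseteq> hardy_torus" unfolding hardy_torus_def fourier_torus_eq by fast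
  qed
  show ?thesis
    unfolding eq by (rule closed_subspace_Inter)
      (auto intro!: closed_subspace_orthogonal closed_subspace_L2 exI[of _ "-1"])
qed

text \<open>
  Limits of combinations of the \<open>diag_poly n\<close> lie in the Hardy space, because it is closed and contains
  each \<open>diag_poly n\<close>.
\<close>

lemma diag_space_eq: "diag_space = closed_span torus diag_poly"
proof -
  have "closed_span torus diag_poly \<subseteq> hardy_torus"
    by (rule closed_span_least[OF closed_subspace_hardy_torus])
      (auto simp: hardy_torus_def fourier_torus_diag_poly)
  then show ?thesis unfolding diag_space_def closed_span_def hardy_torus_def by auto
qed

lemma closed_subspace_diag_space: "closed_subspace torus diag_space"
  unfolding diag_space_eq by (rule closed_subspace_closed_span) simp

lemma diag_space_L2: "f \<in> diag_space \<Longrightarrow> f \<in> L2 torus"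
  by (simp add: diag_space_def hardy_torus_def)

lemma diag_space_hardy: "f \<in> diag_space \<Longrightarrow> f \<in> hardy_torus"
  by (simp add: diag_space_def)

lemma diag_poly_in_diag_space: "diag_poly m \<in> diag_space"
  unfolding diag_space_eq by (rule closed_span_contains) simp

lemma diag_space_orthogonalI:
  assumes h: "h \<in> L2 torus" and p: "\<And>m. L2_inner torus h (diag_poly m) = 0" and f: "f \<in> diag_space"
  shows "L2_inner torus h f = 0"
proof -
  have "closed_span torus diag_poly \<subseteq> {f \<in> L2 torus. L2_inner torus f h = 0}"
    by (rule closed_span_least[OF closed_subspace_orthogonal[OF closed_subspace_L2 h]])
      (simp add: L2_inner_commute[of torus _ h] p)
  then show ?thesis using f unfolding diag_space_eq by (auto simp: L2_inner_commute[of torus h])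
qed

text \<open>
  Each \<open>diag_poly m\<close> has equal coefficients at all points of the quadrant with the same \<open>a + b\<close>. The
  difference of two coefficients is an inner product with a fixed function, so the identity passes to the
  closed span.
\<close>

lemma fourier_torus_diag_space:
  assumes q: "q \<in> diag_space" and ab: "0 \<le> a" "0 \<le> b"
  shows "fourier_torus q (a + 1) b = fourier_torus q a (b + 1)"
proof -
  define h where "h = (\<lambda>x. torus_character (a + 1) b x - torus_character a (b + 1) x)"
  have h: "h \<in> L2 torus" unfolding h_def by (intro L2_diff torus_character_L2)
  have inner: "L2_inner torus f h = fourier_torus f (a + 1) b - fourier_torus f a (b + 1)"
    if "f \<in> L2 torus" for f
    unfolding h_def fourier_torus_eq using that by (simp add: L2_inner_diff_right)
  have "L2_inner torus h (diag_poly m) = 0" for m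
    by (subst L2_inner_commute) (use ab in \<open>simp add: inner fourier_torus_diag_poly\<close>)
  then have "L2_inner torus h q = 0" by (rule diag_space_orthogonalI[OF h _ q])
  then have "L2_inner torus q h = 0" by (simp add: L2_inner_commute[of torus q])
  then show ?thesis using inner[OF diag_space_L2[OF q]] by simp
qed

section \<open>The Bergman shift as a compression of multiplication\<close>

lemma L2_mult_fst: "f \<in> L2 torus \<Longrightarrow> (\<lambda>x. fst x * f x) \<in> L2 torus"
  using L2_mult_unimodular[OF _ torus_character_measurable torus_character_unimodular, of f 1 0]
  by (simp add: torus_character_def)

lemma L2_mult_snd_power: "f \<in> L2 torus \<Longrightarrow> (\<lambda>x. snd x ^ k * f x) \<in> L2 torus"
  using L2_mult_unimodular[OF _ torus_character_measurable torus_character_unimodular, of f 0 "int k"]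
  by (simp add: torus_character_def)

lemma hardy_torus_L2: "f \<in> hardy_torus \<Longrightarrow> f \<in> L2 torus"
  by (simp add: hardy_torus_def)

lemma hardy_torus_fourier: "f \<in> hardy_torus \<Longrightarrow> m < 0 \<or> n < 0 \<Longrightarrow> fourier_torus f m n = 0"
  unfolding hardy_torus_def by blast

text \<open>
  The inner product with \<open>diag_poly m\<close> sums the Fourier coefficients over the antidiagonal \<open>i + j = m\<close>.
  Multiplication by \<open>w\<^sup>k\<close> moves this to the antidiagonal \<open>i + j = m - k\<close>, and the terms that leave the quadrant
  vanish because \<open>f\<close> is a Hardy function.
\<close>

lemma L2_inner_snd_power_diag_poly:
  assumes f: "f \<in> hardy_torus"
  shows "L2_inner torus (\<lambda>x. snd x ^ k * f x) (diag_poly m)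
      = (if k \<le> m then L2_inner torus f (diag_poly (m - k)) else 0)"
proof -
  note fL = hardy_torus_L2[OF f]
  have "L2_inner torus (\<lambda>x. snd x ^ k * f x) (diag_poly m)
      = (\<Sum>i\<le>m. fourier_torus (\<lambda>x. torus_character 0 (int k) x * f x) (int i) (int m - int i))"
    by (subst L2_inner_diag_poly[OF L2_mult_snd_power[OF fL]]) (simp add: torus_character_def)
  also have "\<dots> = (\<Sum>i\<le>m. fourier_torus f (int i) (int m - int i - int k))"
    by (simp add: fourier_torus_mult_character[OF fL])
  also have "\<dots> = (if k \<le> m then L2_inner torus f (diag_poly (m - k)) else 0)"
  proof (cases "k \<le> m")
    case True
    have "(\<Sum>i\<le>m. fourier_torus f (int i) (int m - int i - int k))
        = (\<Sum>i\<le>m - k. fourier_torus f (int i) (int (m - k) - int i))"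
      using True by (intro sum.mono_neutral_cong_right) (auto intro!: hardy_torus_fourier[OF f] simp: algebra_simps)
    then show ?thesis using True by (simp add: L2_inner_diag_poly[OF fL])
  next
    case False
    then show ?thesis by (auto intro!: sum.neutral hardy_torus_fourier[OF f])
  qed
  finally show ?thesis .
qed

lemma L2_inner_fst_diag_poly:
  assumes f: "f \<in> hardy_torus"
  shows "L2_inner torus (\<lambda>x. fst x * f x) (diag_poly m)
      = (if 1 \<le> m then L2_inner torus f (diag_poly (m - 1)) else 0)"
proof -
  note fL = hardy_torus_L2[OF f]
  have "L2_inner torus (\<lambda>x. fst x * f x) (diag_poly m)
      = (\<Sum>i\<le>m. fourier_torus (\<lambda>x. torus_character 1 0 x * f x) (int i) (int m - int i))"
    by (subst L2_inner_diag_poly[OF L2_mult_fst[OF fL]]) (simp add: torus_character_def)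
  also have "\<dots> = (\<Sum>i\<le>m. fourier_torus f (int i - 1) (int m - int i))"
    by (simp add: fourier_torus_mult_character[OF fL])
  also have "\<dots> = (if 1 \<le> m then L2_inner torus f (diag_poly (m - 1)) else 0)"
  proof (cases m)
    case (Suc k)
    then show ?thesis
      by (simp add: sum.atMost_Suc_shift L2_inner_diag_poly[OF fL] hardy_torus_fourier[OF f] del: sum.atMost_Suc)
  qed (simp add: hardy_torus_fourier[OF f])
  finally show ?thesis .
qed

text \<open>
  The function that the choice operator picks in \<open>orth_proj\<close> is a projection, since one exists.
\<close>

lemma bergman_shift_projection:
  assumes f: "f \<in> diag_space"
  shows "bergman_shift f \<in> diag_space"
    and "h \<in> diag_space \<Longrightarrow> L2_inner torus (\<lambda>x. fst x * f x - bergman_shift f x) h = 0"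
proof -
  obtain g where "g \<in> diag_space" "\<And>h. h \<in> diag_space \<Longrightarrow> L2_inner torus (\<lambda>x. fst x * f x - g x) h = 0"
    using L2_projection_exists[OF closed_subspace_diag_space L2_mult_fst[OF diag_space_L2[OF f]]] by blast
  then have "\<exists>g. g \<in> diag_space \<and> (\<forall>h\<in>diag_space. L2_inner torus (\<lambda>x. fst x * f x - g x) h = 0)"
    by blast
  from someI_ex[OF this]
  have "bergman_shift f \<in> diag_space \<and> (\<forall>h\<in>diag_space. L2_inner torus (\<lambda>x. fst x * f x - bergman_shift f x) h = 0)"
    unfolding bergman_shift_def orth_proj_def by (simp add: case_prod_beta')
  then show "bergman_shift f \<in> diag_space"
    "h \<in> diag_space \<Longrightarrow> L2_inner torus (\<lambda>x. fst x * f x - bergman_shift f x) h = 0" by blast+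
qed

text \<open>
  Tested against \<open>diag_poly m\<close>, the projection in \<open>B\<close> disappears, and multiplication by \<open>z\<close> or by \<open>w\<close>
  lowers \<open>m\<close> by one alike. Hence both sides agree for every \<open>h = diag_poly m\<close>, and by
  density for every \<open>h\<close>.
\<close>

lemma L2_inner_bergman_shift:
  assumes f: "f \<in> diag_space" and h: "h \<in> diag_space"
  shows "L2_inner torus (\<lambda>x. snd x ^ k * bergman_shift f x) h = L2_inner torus (\<lambda>x. snd x ^ Suc k * f x) h"
proof -
  note B = bergman_shift_projection[OF f]
  note L = L2_mult_snd_power[OF diag_space_L2[OF B(1)], of k] L2_mult_snd_power[OF diag_space_L2[OF f], of "Suc k"]
  have B_diag_poly: "L2_inner torus (bergman_shift f) (diag_poly m)
      = (if 1 \<le> m then L2_inner torus f (diag_poly (m - 1)) else 0)" for m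
    using B(2)[OF diag_poly_in_diag_space[of m]] L2_inner_fst_diag_poly[OF diag_space_hardy[OF f], of m]
    by (simp add: L2_inner_diff_left L2_mult_fst diag_space_L2 f B(1))
  have "L2_inner torus (\<lambda>x. snd x ^ k * bergman_shift f x - snd x ^ Suc k * f x) h = 0"
  proof (rule diag_space_orthogonalI[OF L2_diff[OF L] _ h])
    fix m
    show "L2_inner torus (\<lambda>x. snd x ^ k * bergman_shift f x - snd x ^ Suc k * f x) (diag_poly m) = 0"
      unfolding L2_inner_diff_left[OF L diag_poly_L2]
        L2_inner_snd_power_diag_poly[OF diag_space_hardy[OF f]]
        L2_inner_snd_power_diag_poly[OF diag_space_hardy[OF B(1)]] B_diag_poly by auto
  qed
  then show ?thesis using L2_inner_diff_left[OF L diag_space_L2[OF h]] by simp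
qed

section \<open>Slices and the backward shift\<close>

interpretation circle: prob_space circle by (rule prob_space_circle)
interpretation torus: pair_prob_space circle circle ..

lemma measurable_slice_integral:
  fixes f :: "complex \<times> complex \<Rightarrow> 'b::{banach, second_countable_topology}"
  assumes "f \<in> borel_measurable torus"
  shows "(\<lambda>w. LINT z|circle. f (z, w)) \<in> borel_measurable circle"
proof -
  have [measurable]: "f \<in> borel_measurable (circle \<Otimes>\<^sub>M circle)" using assms by (simp add: torus_def)
  show ?thesis by measurable
qed

definition slice_coeff :: "(complex \<times> complex \<Rightarrow> complex) \<Rightarrow> int \<Rightarrow> complex \<Rightarrow> complex" where
  "slice_coeff q j w = fourier_circle (\<lambda>z. q (z, w)) j"

definition slice_energy :: "(complex \<times> complex \<Rightarrow> complex) \<Rightarrow> complex \<Rightarrow> real" where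
  "slice_energy q w = (LINT z|circle. (cmod (q (z, w)))\<^sup>2)"

lemma circle_power_L2 [simp]: "(\<lambda>w. w powi n) \<in> L2 circle"
proof -
  have "AE w in circle. cmod (w powi n) = 1"
    using AE_circle by eventually_elim (simp add: norm_power_int)
  from L2_mult_unimodular[OF L2_const[OF prob_space_circle, of 1] _ this] show ?thesis by simp
qed

lemma L2_norm_circle_power: "L2_norm circle (\<lambda>w. w powi n) = 1"
proof -
  have "(LINT w|circle. (cmod (w powi n))\<^sup>2) = (LINT w|circle. 1)"
  proof (rule integral_cong_AE)
    show "AE w in circle. (cmod (w powi n))\<^sup>2 = 1"
      using AE_circle by eventually_elim (simp add: norm_power_int)
  qed measurable
  then show ?thesis by (simp add: L2_norm_def circle.prob_space[unfolded space_circle])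
qed

lemma slice_L2:
  assumes q: "q \<in> L2 torus"
  shows "AE w in circle. (\<lambda>z. q (z, w)) \<in> L2 circle"
proof -
  have [measurable]: "q \<in> borel_measurable (circle \<Otimes>\<^sub>M circle)" using L2_borel[OF q] by (simp add: torus_def)
  have "integrable (circle \<Otimes>\<^sub>M circle) (\<lambda>(z, w). (cmod (q (z, w)))\<^sup>2)"
    using L2_sq_integrable[OF q] by (simp add: torus_def case_prod_beta')
  from torus.AE_integrable_snd[OF this] show ?thesis
    by eventually_elim (simp add: L2_def)
qed

lemma slice_energy_integrable:
  assumes q: "q \<in> L2 torus"
  shows "integrable circle (slice_energy q)"
proof -
  have "integrable (circle \<Otimes>\<^sub>M circle) (\<lambda>(z, w). (cmod (q (z, w)))\<^sup>2)"
    using L2_sq_integrable[OF q] by (simp add: torus_def case_prod_beta')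
  from torus.integrable_snd[OF this] show ?thesis
    unfolding slice_energy_def[abs_def] .
qed

lemma slice_coeff_measurable:
  assumes "q \<in> L2 torus"
  shows "slice_coeff q j \<in> borel_measurable circle"
proof -
  have [measurable]: "q \<in> borel_measurable torus" using assms by (rule L2_borel)
  have "(\<lambda>x. q x * cnj (fst x powi j)) \<in> borel_measurable torus"
    by measurable
  from measurable_slice_integral[OF this] show ?thesis
    by (simp only: slice_coeff_def[abs_def] fourier_circle_def L2_inner_def fst_conv)
qed

text \<open>
  By the Cauchy--Schwarz inequality on the slice, \<open>|slice_coeff q j|\<^sup>2\<close> is dominated by \<open>slice_energy q\<close>.
\<close>

lemma slice_coeff_L2:
  assumes q: "q \<in> L2 torus"
  shows "slice_coeff q j \<in> L2 circle"
  unfolding L2_def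
proof (safe)
  show [measurable]: "slice_coeff q j \<in> borel_measurable circle" by (rule slice_coeff_measurable[OF q])
  show "integrable circle (\<lambda>w. (cmod (slice_coeff q j w))\<^sup>2)"
  proof (rule Bochner_Integration.integrable_bound[OF slice_energy_integrable[OF q]])
    show "AE w in circle. norm ((cmod (slice_coeff q j w))\<^sup>2) \<le> norm (slice_energy q w)"
      using slice_L2[OF q]
    proof eventually_elim
      case (elim w)
      have "cmod (slice_coeff q j w) \<le> L2_norm circle (\<lambda>z. q (z, w))"
        unfolding slice_coeff_def fourier_circle_def
        using L2_Cauchy_Schwarz[OF elim circle_power_L2[of j]] by (simp add: L2_norm_circle_power)
      then have "(cmod (slice_coeff q j w))\<^sup>2 \<le> (L2_norm circle (\<lambda>z. q (z, w)))\<^sup>2"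
        by (rule power_mono) simp
      then show ?case by (simp add: L2_norm_sq slice_energy_def)
    qed
  qed measurable
qed

lemma fourier_slice_coeff:
  assumes q: "q \<in> L2 torus"
  shows "fourier_circle (slice_coeff q j) n = fourier_torus q j n"
proof -
  have "integrable (circle \<Otimes>\<^sub>M circle) (\<lambda>(z, w). q (z, w) * cnj (torus_character j n (z, w)))"
    using L2_inner_integrable[OF q torus_character_L2[of j n]] by (simp add: torus_def case_prod_beta')
  from torus.integral_snd[OF this]
  have "fourier_torus q j n = (LINT w|circle. LINT z|circle. q (z, w) * cnj (torus_character j n (z, w)))"
    by (simp add: fourier_torus_eq L2_inner_def torus_def case_prod_beta')
  also have "\<dots> = (LINT w|circle. LINT z|circle. q (z, w) * cnj (z powi j) * cnj (w powi n))"
    by (simp add: torus_character_def mult.assoc)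
  also have "\<dots> = (LINT w|circle. slice_coeff q j w * cnj (w powi n))"
    by (simp only: slice_coeff_def fourier_circle_def L2_inner_def integral_mult_left_zero)
  finally show ?thesis by (simp add: fourier_circle_def L2_inner_def)
qed

text \<open>
  This Fubini identity links the analytic condition to the operator: the right-hand side is a
  diagonal matrix entry of multiplication by \<open>w\<^sup>n\<close>.
\<close>

lemma fourier_slice_energy:
  assumes q: "q \<in> L2 torus"
  shows "(LINT w|circle. w ^ n * of_real (slice_energy q w)) = L2_inner torus (\<lambda>x. snd x ^ n * q x) q"
proof -
  have "integrable (circle \<Otimes>\<^sub>M circle) (\<lambda>(z, w). w ^ n * q (z, w) * cnj (q (z, w)))"
    using L2_inner_integrable[OF L2_mult_snd_power[OF q, of n] q]
    by (simp add: torus_def case_prod_beta')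
  from torus.integral_snd[OF this]
  have "L2_inner torus (\<lambda>x. snd x ^ n * q x) q
      = (LINT w|circle. LINT z|circle. w ^ n * q (z, w) * cnj (q (z, w)))"
    by (simp add: L2_inner_def torus_def case_prod_beta')
  also have "\<dots> = (LINT w|circle. LINT z|circle. w ^ n * of_real ((cmod (q (z, w)))\<^sup>2))"
    by (simp only: complex_norm_square mult.assoc)
  also have "\<dots> = (LINT w|circle. w ^ n * of_real (slice_energy q w))"
    by (simp only: integral_mult_right_zero integral_complex_of_real slice_energy_def)
  finally show ?thesis ..
qed

lemma fourier_circle_diff:
  assumes "f \<in> L2 circle" "g \<in> L2 circle"
  shows "fourier_circle (\<lambda>w. f w - g w) n = fourier_circle f n - fourier_circle g n"
  unfolding fourier_circle_def by (rule L2_inner_diff_left[OF assms circle_power_L2])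

lemma L2_circle_eqI:
  assumes "f \<in> L2 circle" "g \<in> L2 circle" "\<And>n. fourier_circle f n = fourier_circle g n"
  shows "AE w in circle. f w = g w"
proof -
  have "AE w in circle. f w - g w = 0"
    using assms by (intro fourier_circle_unique L2_integrable[OF prob_space_circle] L2_diff)
      (simp_all add: fourier_circle_diff)
  then show ?thesis by simp
qed

lemma backward_shift_L2:
  assumes f: "f \<in> L2 circle"
  shows "backward_shift f \<in> L2 circle"
proof -
  have "(\<lambda>w. inverse w * (f w - fourier_circle f 0)) \<in> L2 circle"
  proof (rule L2_mult_unimodular)
    show "(\<lambda>w. f w - fourier_circle f 0) \<in> L2 circle"
      by (intro L2_diff f L2_const[OF prob_space_circle])
    show "AE w in circle. cmod (inverse w) = 1"
      using AE_circle by eventually_elim (simp add: norm_inverse)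
  qed measurable
  then show ?thesis by (simp add: backward_shift_def[abs_def] divide_inverse mult.commute)
qed

lemma backward_shift_cong:
  assumes "AE w in circle. f w = g w" "f \<in> L2 circle" "g \<in> L2 circle"
  shows "AE w in circle. backward_shift f w = backward_shift g w"
proof -
  have "fourier_circle f 0 = fourier_circle g 0"
    unfolding fourier_circle_def L2_inner_def
    using assms by (intro integral_cong_AE) (auto elim: eventually_mono)
  with assms(1) show ?thesis by (auto simp: backward_shift_def elim: eventually_mono)
qed

text \<open>
  Both functions have the same Fourier coefficients: in degree \<open>n \<ge> 0\<close> this is the constancy of the
  coefficients of \<open>q\<close> along antidiagonals, and in negative degree both vanish.
\<close>

lemma backward_shift_slice_coeff:
  assumes q: "q \<in> diag_space"
  shows "AE w in circle. backward_shift (slice_coeff q (int j)) w = slice_coeff q (int (Suc j)) w"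
proof (rule L2_circle_eqI)
  note qL = diag_space_L2[OF q]
  show "fourier_circle (backward_shift (slice_coeff q (int j))) n = fourier_circle (slice_coeff q (int (Suc j))) n" for n
  proof (cases "n \<ge> 0")
    case True
    then show ?thesis
      using fourier_torus_diag_space[OF q, of "int j" n]
      by (simp add: fourier_backward_shift slice_coeff_L2 qL fourier_slice_coeff add.commute)
  next
    case False
    then show ?thesis
      using hardy_torus_fourier[OF diag_space_hardy[OF q]]
      by (simp add: fourier_backward_shift slice_coeff_L2 qL fourier_slice_coeff)
  qed
qed (use diag_space_L2[OF q] in \<open>auto intro: backward_shift_L2 slice_coeff_L2\<close>)

lemma slice_zero_eq: "slice_zero q = slice_coeff q 0"
  by (simp add: slice_zero_def slice_coeff_def[abs_def] fourier_circle_def L2_inner_def)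

lemma backward_shift_iterate_slice:
  assumes q: "q \<in> diag_space"
  shows "(backward_shift ^^ j) (slice_zero q) \<in> L2 circle \<and>
    (AE w in circle. (backward_shift ^^ j) (slice_zero q) w = slice_coeff q (int j) w)"
proof (induction j)
  case 0
  show ?case using slice_coeff_L2[OF diag_space_L2[OF q]] by (simp add: slice_zero_eq)
next
  case (Suc j)
  from backward_shift_cong[OF conjunct2[OF Suc] conjunct1[OF Suc] slice_coeff_L2[OF diag_space_L2[OF q]]]
    backward_shift_slice_coeff[OF q, of j]
  have "AE w in circle. (backward_shift ^^ Suc j) (slice_zero q) w = slice_coeff q (int (Suc j)) w"
    by eventually_elim simp
  then show ?case using Suc by (simp add: backward_shift_L2)
qed

text \<open>
  The difference between \<open>g\<close> and its projection onto the closed span of the nonnegative powers is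
  orthogonal to all integer powers, so it vanishes almost everywhere. Thus \<open>g\<close> lies in that span, where
  Parseval's identity for orthonormal sequences applies.
\<close>

lemma Parseval_hardy_circle:
  assumes g: "g \<in> L2 circle" and neg: "\<And>n. n < 0 \<Longrightarrow> fourier_circle g n = 0"
  shows "(\<lambda>n. (cmod (fourier_circle g (int n)))\<^sup>2) sums (LINT w|circle. (cmod (g w))\<^sup>2)"
proof -
  define e where "e n = (\<lambda>w::complex. w powi int n)" for n
  have e: "e n \<in> L2 circle" for n unfolding e_def by (rule circle_power_L2)
  have inner_powi: "L2_inner circle (\<lambda>w. w powi m) (\<lambda>w. w powi n) = (if m = n then 1 else 0)" for m n
  proof -
    have "L2_inner circle (\<lambda>w. w powi m) (\<lambda>w. w powi n) = (LINT w|circle. w powi (m - n))"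
      unfolding L2_inner_def
    proof (rule integral_cong_AE)
      show "AE w in circle. w powi m * cnj (w powi n) = w powi (m - n)"
        using AE_circle
      proof eventually_elim
        case (elim w)
        then have "w \<noteq> 0" by auto
        then show ?case using power_int_add[of w m "- n"] by (simp add: cnj_powi_circle[OF elim] del: complex_cnj_power_int)
      qed
    qed measurable
    then show ?thesis by (simp add: integral_powi_circle)
  qed
  have orth: "L2_inner circle (e m) (e n) = (if m = n then 1 else 0)" for m n
    unfolding e_def inner_powi by simp
  have S: "closed_subspace circle (closed_span circle e)"
    by (rule closed_subspace_closed_span) (rule e)
  obtain p where p: "p \<in> closed_span circle e"
      "\<And>h. h \<in> closed_span circle e \<Longrightarrow> L2_inner circle (\<lambda>x. g x - p x) h = 0"
    using L2_projection_exists[OF S g] by blast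
  have pL: "p \<in> L2 circle" using closed_subspaceD(1)[OF S p(1)] .
  have "AE w in circle. g w = p w"
  proof (rule L2_circle_eqI[OF g pL])
    fix n :: int
    show "fourier_circle g n = fourier_circle p n"
    proof (cases "n < 0")
      case True
      have orth_n: "L2_inner circle (e k) (\<lambda>w. w powi n) = 0" for k
        unfolding e_def inner_powi using True by simp
      have "L2_inner circle (\<lambda>w. w powi n) f = 0" if "f \<in> closed_span circle e" for f
      proof -
        have "closed_span circle e \<subseteq> {f \<in> L2 circle. L2_inner circle f (\<lambda>w. w powi n) = 0}"
          by (rule closed_span_least[OF closed_subspace_orthogonal[OF closed_subspace_L2 circle_power_L2]])
            (simp add: e orth_n)
        then show ?thesis using that by (auto simp: L2_inner_commute[of circle "\<lambda>w. w powi n"])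
      qed
      from this[OF p(1)] have "fourier_circle p n = 0"
        by (simp add: fourier_circle_def L2_inner_commute[of circle p])
      then show ?thesis using neg[OF True] by simp
    next
      case False
      then have "(\<lambda>w. w powi n) = e (nat n)" by (simp add: e_def)
      then have "L2_inner circle (\<lambda>x. g x - p x) (\<lambda>w. w powi n) = 0"
        using p(2)[OF closed_span_contains[where b = e and m = "nat n", OF e]] by simp
      then show ?thesis
        using L2_inner_diff_left[OF g pL circle_power_L2[of n]] by (simp add: fourier_circle_def)
    qed
  qed
  then have "g \<in> closed_span circle e"
    by (intro closed_subspace_cong_AE[OF S p(1) g]) (auto elim: eventually_mono)
  from L2_Parseval[where e = e, OF e orth this] show ?thesis
    by (simp add: fourier_circle_def e_def L2_norm_sq)
qed

text \<open>
  This is what makes almost every slice of a Hardy function on the torus a Hardy function on the circle.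
\<close>

lemma slice_coeff_negative:
  assumes q: "q \<in> hardy_torus" and j: "j < 0"
  shows "AE w in circle. slice_coeff q j w = 0"
proof (rule L2_circle_eqI)
  show "fourier_circle (slice_coeff q j) n = fourier_circle (\<lambda>w. 0) n" for n
    using hardy_torus_fourier[OF q, of j n] j
    by (simp add: fourier_slice_coeff hardy_torus_L2[OF q]) (simp add: fourier_circle_def)
qed (simp_all add: slice_coeff_L2 hardy_torus_L2[OF q])

lemma backward_shift_energy:
  assumes q: "q \<in> diag_space"
  shows "AE w in circle. (\<lambda>j. (cmod ((backward_shift ^^ j) (slice_zero q) w))\<^sup>2) sums slice_energy q w"
proof -
  have "AE w in circle. \<forall>j. (backward_shift ^^ j) (slice_zero q) w = slice_coeff q (int j) w"
    using backward_shift_iterate_slice[OF q] by (simp add: AE_all_countable)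
  moreover have "AE w in circle. \<forall>j::int. j < 0 \<longrightarrow> slice_coeff q j w = 0"
    using slice_coeff_negative[OF diag_space_hardy[OF q]] by (simp add: AE_all_countable AE_impI)
  ultimately show ?thesis using slice_L2[OF diag_space_L2[OF q]]
  proof eventually_elim
    case (elim w)
    have "(\<lambda>j. (cmod (slice_coeff q (int j) w))\<^sup>2) sums slice_energy q w"
      using Parseval_hardy_circle[OF elim(3)] elim(2) by (simp add: slice_coeff_def slice_energy_def)
    then show ?case using elim(1) by simp
  qed
qed

text \<open>
  The energy is real, so its Fourier coefficients of negative order are conjugates of those of positive
  order; it is constant exactly when the latter vanish.
\<close>

lemma constant_energy_iff:
  assumes q: "q \<in> diag_space"
  shows "(\<exists>c::real. AE w in circle. (\<lambda>j. (cmod ((backward_shift ^^ j) (slice_zero q) w))\<^sup>2) sums c)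
    \<longleftrightarrow> (\<forall>n\<ge>1. L2_inner torus (\<lambda>x. snd x ^ n * q x) q = 0)"
proof -
  note qL = diag_space_L2[OF q]
  note int = slice_energy_integrable[OF qL]
  have [measurable]: "slice_energy q \<in> borel_measurable borel"
    using borel_measurable_integrable[OF int] by simp
  have "(AE w in circle. (\<lambda>j. (cmod ((backward_shift ^^ j) (slice_zero q) w))\<^sup>2) sums c)
      \<longleftrightarrow> (AE w in circle. slice_energy q w = c)" for c :: real
  proof
    assume "AE w in circle. (\<lambda>j. (cmod ((backward_shift ^^ j) (slice_zero q) w))\<^sup>2) sums c"
    with backward_shift_energy[OF q] show "AE w in circle. slice_energy q w = c"
      by eventually_elim (rule sums_unique2)
  next
    assume "AE w in circle. slice_energy q w = c"
    with backward_shift_energy[OF q]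
    show "AE w in circle. (\<lambda>j. (cmod ((backward_shift ^^ j) (slice_zero q) w))\<^sup>2) sums c"
      by eventually_elim simp
  qed
  moreover have "(\<exists>c. AE w in circle. slice_energy q w = c)
      \<longleftrightarrow> (\<forall>n\<ge>1. (LINT w|circle. w ^ n * of_real (slice_energy q w)) = 0)"
  proof safe
    fix c and n :: nat assume c: "AE w in circle. slice_energy q w = c" and n: "1 \<le> n"
    have "(LINT w|circle. w ^ n * of_real (slice_energy q w)) = (LINT w|circle. w powi int n * of_real c)"
    proof (rule integral_cong_AE)
      show "AE w in circle. w ^ n * of_real (slice_energy q w) = w powi int n * of_real c"
        using c by eventually_elim simp
    qed measurable
    also have "\<dots> = 0" using n by (simp only: integral_mult_left_zero integral_powi_circle) simp
    finally show "(LINT w|circle. w ^ n * of_real (slice_energy q w)) = 0" .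
  next
    assume zero: "\<forall>n\<ge>1. (LINT w|circle. w ^ n * of_real (slice_energy q w)) = 0"
    define c where "c = (LINT w|circle. slice_energy q w)"
    define h where "h w = complex_of_real (slice_energy q w - c)" for w
    have h: "integrable circle h" unfolding h_def[abs_def] using int by simp
    have pos: "(LINT w|circle. w ^ n * h w) = 0" for n
    proof -
      have "(LINT w|circle. w ^ n * h w)
          = (LINT w|circle. w ^ n * of_real (slice_energy q w) - w powi int n * of_real c)"
        by (simp add: h_def right_diff_distrib)
      also have "\<dots> = (LINT w|circle. w ^ n * of_real (slice_energy q w)) - (LINT w|circle. w powi int n * of_real c)"
      proof (rule Bochner_Integration.integral_diff)
        show "integrable circle (\<lambda>w. w ^ n * of_real (slice_energy q w))"
          using integrable_circle_bounded_mult[of "\<lambda>w. of_real (slice_energy q w)" "\<lambda>w. w ^ n" 1] int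
          by (simp add: norm_power mult.commute)
        show "integrable circle (\<lambda>w. w powi int n * of_real c)"
          using L2_integrable[OF prob_space_circle circle_power_L2[of "int n"]] by simp
      qed
      also have "\<dots> = 0"
      proof (cases "n = 0")
        case True
        then show ?thesis by (simp add: c_def circle.prob_space[unfolded space_circle])
      next
        case False
        then show ?thesis using zero by (simp only: integral_mult_left_zero integral_powi_circle) simp
      qed
      finally show ?thesis .
    qed
    have "fourier_circle h n = 0" for n
    proof (cases "n \<ge> 0")
      case True
      have "fourier_circle h n = cnj (LINT w|circle. w ^ nat n * h w)"
        unfolding fourier_circle_def L2_inner_def using True
        by (subst Bochner_Integration.integral_cnj[symmetric])
          (simp add: power_int_def h_def mult.commute)
      then show ?thesis using pos by simp
    next
      case False
      have "fourier_circle h n = (LINT w|circle. w ^ nat (- n) * h w)"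
        unfolding fourier_circle_def L2_inner_def
      proof (rule integral_cong_AE)
        show "AE w in circle. h w * cnj (w powi n) = w ^ nat (- n) * h w"
          using AE_circle
        proof eventually_elim
          case (elim w)
          have "w powi (- n) = w ^ nat (- n)" using False by (simp add: power_int_def)
          then show ?case unfolding cnj_powi_circle[OF elim] by (simp only: mult.commute)
        qed
      qed (simp_all add: h_def[abs_def])
      then show ?thesis using pos by simp
    qed
    from fourier_circle_unique[OF h this] have "AE w in circle. slice_energy q w = c"
      by eventually_elim (simp add: h_def)
    then show "\<exists>c. AE w in circle. slice_energy q w = c" ..
  qed
  ultimately show ?thesis by (simp only: fourier_slice_energy[OF qL])
qed

section \<open>Wandering subspaces\<close>

text \<open>
  The sesquilinear form \<open>F(u, v) = \<langle>m u, v\<rangle>\<close> need not be Hermitian, so the polarisation uses complex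
  scalars: expanding \<open>F(f + c g, f + c g) = 0\<close> for \<open>c = 1\<close> and \<open>c = \<i>\<close> gives \<open>F(f, g) + F(g, f) = 0\<close> and
  \<open>F(f, g) - F(g, f) = 0\<close>.
\<close>

lemma L2_polarization:
  assumes W: "closed_subspace M W" and T: "\<And>f. f \<in> W \<Longrightarrow> (\<lambda>x. m x * f x) \<in> L2 M"
    and zero: "\<And>f. f \<in> W \<Longrightarrow> L2_inner M (\<lambda>x. m x * f x) f = 0"
    and f: "f \<in> W" and g: "g \<in> W"
  shows "L2_inner M (\<lambda>x. m x * f x) g = 0"
proof -
  note D = closed_subspaceD[OF W]
  define F where "F u v = L2_inner M (\<lambda>x. m x * u x) v" for u v
  have "F (\<lambda>x. f x + c * g x) (\<lambda>x. f x + c * g x) = F f f + cnj c * F f g + c * F g f + c * cnj c * F g g" for c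
  proof -
    have cg: "(\<lambda>x. c * g x) \<in> W" using g D by blast
    have "(\<lambda>x. m x * (f x + c * g x)) = (\<lambda>x. m x * f x + m x * (c * g x))"
      by (simp add: distrib_left)
    moreover have "(\<lambda>x. m x * (c * g x)) = (\<lambda>x. c * (m x * g x))" by (simp add: mult_ac)
    ultimately show ?thesis
      unfolding F_def using f g cg D(1) T L2_scale[OF T[OF g], of c]
      by (simp add: L2_inner_add_left L2_inner_add_right L2_inner_scale_left L2_inner_scale_right L2_add algebra_simps)
  qed
  moreover have "(\<lambda>x. f x + c * g x) \<in> W" for c using f g D by blast
  ultimately have eq: "cnj c * F f g + c * F g f = 0" for c
    using zero f g by (simp add: F_def)
  have "F f g + F g f = 0" using eq[of 1] by simp
  moreover have "F f g - F g f = 0"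
    using eq[of \<i>] by (simp add: complex_eq_iff)
  ultimately have "2 * F f g = 0" by (simp add: algebra_simps)
  then show ?thesis by (simp add: F_def)
qed

text \<open>
  For \<open>n = 0\<close> the inner product is \<open>\<langle>B g, q\<rangle>\<close>. A factor \<open>w\<close> can be traded for an application of \<open>B\<close> to \<open>g\<close>,
  which stays in \<open>M\<close>; this reduces \<open>n + 1\<close> to \<open>n\<close>.
\<close>

lemma wandering_orthogonal_shifts:
  assumes M: "invariant_subspace M" and q: "q \<in> wandering_subspace M" and g: "g \<in> M"
  shows "L2_inner torus (\<lambda>x. snd x ^ Suc n * g x) q = 0"
  using g
proof (induction n arbitrary: g)
  have MD: "M \<subseteq> diag_space" and inv: "bergman_shift ` M \<subseteq> M"
    using M by (auto simp: invariant_subspace_def)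
  have qM: "q \<in> diag_space" using q MD by (auto simp: wandering_subspace_def)
  case 0
  have "L2_inner torus q (bergman_shift g) = 0" using q 0 by (auto simp: wandering_subspace_def)
  then have "L2_inner torus (bergman_shift g) q = 0" by (simp add: L2_inner_commute[of torus _ q])
  then show ?case using L2_inner_bergman_shift[of g q 0] 0 MD qM by auto
next
  case (Suc n)
  have MD: "M \<subseteq> diag_space" and inv: "bergman_shift ` M \<subseteq> M"
    using M by (auto simp: invariant_subspace_def)
  have qM: "q \<in> diag_space" using q MD by (auto simp: wandering_subspace_def)
  have "L2_inner torus (\<lambda>x. snd x ^ Suc n * bergman_shift g x) q = 0"
    using Suc.prems inv by (intro Suc.IH) blast
  then show ?case using L2_inner_bergman_shift[of g q "Suc n"] Suc.prems MD qM by auto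
qed

text \<open>
  The witness is the smallest invariant subspace \<open>M\<close> containing \<open>W\<close>. Both inclusions use minimality: an
  orthogonality relation holds on all of \<open>M\<close> as soon as it holds on \<open>W\<close> and defines an invariant
  subspace.
\<close>

lemma wandering_subspace_exists:
  assumes W: "closed_subspace torus W" "W \<subseteq> diag_space"
    and orth: "\<And>f g n. f \<in> W \<Longrightarrow> g \<in> W \<Longrightarrow> L2_inner torus (\<lambda>x. snd x ^ Suc n * f x) g = 0"
  shows "\<exists>M. invariant_subspace M \<and> W = wandering_subspace M"
proof -
  define \<M> where "\<M> = {M. invariant_subspace M \<and> W \<subseteq> M}"
  define M where "M = \<Inter>\<M>"
  have M_le: "M \<subseteq> N" if "invariant_subspace N" "W \<subseteq> N" for N
    using that unfolding M_def \<M>_def by blast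
  have "diag_space \<in> \<M>"
    using W(2) closed_subspace_diag_space bergman_shift_projection(1)
    by (auto simp: \<M>_def invariant_subspace_def)
  then have MD: "M \<subseteq> diag_space" and ne: "\<M> \<noteq> {}" unfolding M_def by blast+
  have WM: "W \<subseteq> M" unfolding M_def \<M>_def by blast
  have M_closed: "closed_subspace torus M"
    unfolding M_def by (rule closed_subspace_Inter[OF ne]) (simp add: \<M>_def invariant_subspace_def)
  have M_inv: "bergman_shift f \<in> M" if "f \<in> M" for f
    using that unfolding M_def \<M>_def invariant_subspace_def by blast
  have M: "invariant_subspace M"
    using M_closed MD M_inv by (auto simp: invariant_subspace_def)
  \<comment> \<open>The functions whose images under multiplication by \<open>w\<^sup>n\<close>, \<open>n \<ge> 1\<close>, are orthogonal to \<open>W\<close> form an invariant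
    subspace \<open>N\<close>. Moving the factor to the other side, by \<open>H\<close>, shows that \<open>N\<close> is closed.\<close>
  define H where "H = (\<lambda>(w, n) x. cnj (snd x ^ Suc n) * w x) ` (W \<times> UNIV)"
  have adj: "L2_inner torus f (\<lambda>x. cnj (snd x ^ n) * w x) = L2_inner torus (\<lambda>x. snd x ^ n * f x) w" for f w n
    unfolding L2_inner_def by (simp add: mult_ac)
  have HL: "H \<subseteq> L2 torus"
  proof -
    have "(\<lambda>x. cnj (snd x ^ n) * w x) \<in> L2 torus" if "w \<in> L2 torus" for w n
    proof (rule L2_mult_unimodular[OF that])
      show "AE x in torus. cmod (cnj (snd x ^ n)) = 1"
        using AE_torus by eventually_elim (simp add: norm_power)
    qed measurable
    then show ?thesis using W(2) diag_space_L2 by (auto simp: H_def simp del: power_Suc complex_cnj_power)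
  qed
  define N where "N = {f \<in> diag_space. \<forall>h\<in>H. L2_inner torus f h = 0}"
  have N_iff: "f \<in> N \<longleftrightarrow> f \<in> diag_space \<and> (\<forall>w\<in>W. \<forall>n. L2_inner torus (\<lambda>x. snd x ^ Suc n * f x) w = 0)" for f
    unfolding N_def H_def adj[symmetric] by auto
  have "invariant_subspace N"
    unfolding invariant_subspace_def
  proof (intro conjI subsetI)
    show "closed_subspace torus N"
      unfolding N_def by (rule closed_subspace_orthogonal_set[OF closed_subspace_diag_space HL])
    show "f \<in> diag_space" if "f \<in> N" for f using that by (simp add: N_iff)
    show "f \<in> N" if f: "f \<in> bergman_shift ` N" for f
    proof -
      obtain g where g: "f = bergman_shift g" "g \<in> N" using f by blast
      then show ?thesis
        using W(2) bergman_shift_projection(1) L2_inner_bergman_shift[of g _ "Suc _"]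
        by (auto simp: N_iff simp del: power_Suc)
    qed
  qed
  moreover have "W \<subseteq> N" using W(2) orth by (auto simp: N_iff simp del: power_Suc)
  ultimately have "M \<subseteq> N" by (rule M_le)
  then have W_BM: "L2_inner torus w (bergman_shift f) = 0" if "w \<in> W" "f \<in> M" for w f
  proof -
    have "L2_inner torus (\<lambda>x. snd x ^ Suc 0 * f x) w = 0"
      using \<open>M \<subseteq> N\<close> that N_iff[of f] by blast
    then have "L2_inner torus (bergman_shift f) w = 0"
      using L2_inner_bergman_shift[of f w 0] that MD W(2) by auto
    then show ?thesis by (simp add: L2_inner_commute[of torus w])
  qed
  have "wandering_subspace M \<subseteq> W"
  proof
    fix f assume "f \<in> wandering_subspace M"
    then have f: "f \<in> M" "\<And>g. g \<in> M \<Longrightarrow> L2_inner torus f (bergman_shift g) = 0"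
      by (auto simp: wandering_subspace_def)
    note L = closed_subspaceD(1)[OF M_closed]
    obtain g where g: "g \<in> W" "\<And>h. h \<in> W \<Longrightarrow> L2_inner torus (\<lambda>x. f x - g x) h = 0"
      using L2_projection_exists[OF W(1) L[OF f(1)]] by blast
    define r where "r = (\<lambda>x. f x - g x)"
    have gM: "g \<in> M" using g WM by blast
    have r: "r \<in> M" unfolding r_def by (rule closed_subspace_diff[OF M_closed f(1) gM])
    have r_BM: "L2_inner torus r (bergman_shift h) = 0" if "h \<in> M" for h
      unfolding r_def using f(2)[OF that] W_BM[OF g(1) that]
      by (simp add: L2_inner_diff_left L f(1) gM M_inv that)
    \<comment> \<open>The residual \<open>r\<close> is orthogonal to \<open>W\<close> and to the image of \<open>M\<close> under \<open>B\<close>. So its orthogonal complement in \<open>M\<close>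
      is an invariant subspace containing \<open>W\<close>, hence all of \<open>M\<close>, and \<open>r\<close> is orthogonal to itself.\<close>
    define K where "K = {h \<in> M. L2_inner torus h r = 0}"
    have "invariant_subspace K"
      unfolding invariant_subspace_def K_def
      using closed_subspace_orthogonal[OF M_closed L[OF r]] MD M_inv r_BM
      by (auto simp: L2_inner_commute[of torus _ r])
    moreover have "W \<subseteq> K"
      using WM g(2) by (auto simp: K_def r_def L2_inner_commute[of torus _ "\<lambda>x. f x - g x"])
    ultimately have "r \<in> K" using M_le r by blast
    then have "L2_norm torus r = 0" by (simp add: K_def L2_inner_self)
    then have "AE x in torus. g x = f x"
      using L2_norm_eq_0_iff[OF L[OF r]] by (auto simp: r_def elim: eventually_mono)
    then show "f \<in> W" by (rule closed_subspace_cong_AE[OF W(1) g(1) L[OF f(1)]])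
  qed
  moreover have "W \<subseteq> wandering_subspace M"
    using WM W_BM by (auto simp: wandering_subspace_def)
  ultimately show ?thesis using M by blast
qed

theorem corollary2p4:
  fixes W :: "(complex \<times> complex \<Rightarrow> complex) set"
  assumes "closed_subspace torus W"
    and "W \<subseteq> diag_space"
  shows "(\<exists>M. invariant_subspace M \<and> W = wandering_subspace M) \<longleftrightarrow>
    (\<forall>q\<in>W. \<exists>c::real. AE w in circle.
       (\<lambda>j. (cmod ((backward_shift ^^ j) (slice_zero q) w))\<^sup>2) sums c)"
proof -
  have "(\<exists>M. invariant_subspace M \<and> W = wandering_subspace M) \<longleftrightarrow>
      (\<forall>q\<in>W. \<forall>n\<ge>1. L2_inner torus (\<lambda>x. snd x ^ n * q x) q = 0)"
  proof
    assume "\<exists>M. invariant_subspace M \<and> W = wandering_subspace M"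
    then obtain M where M: "invariant_subspace M" "W = wandering_subspace M" by blast
    show "\<forall>q\<in>W. \<forall>n\<ge>1. L2_inner torus (\<lambda>x. snd x ^ n * q x) q = 0"
    proof (intro ballI allI impI)
      fix q and n :: nat assume q: "q \<in> W" and n: "1 \<le> n"
      have "q \<in> M" using q unfolding M(2) by (simp add: wandering_subspace_def)
      from wandering_orthogonal_shifts[OF M(1) q[unfolded M(2)] this, of "n - 1"] n
      show "L2_inner torus (\<lambda>x. snd x ^ n * q x) q = 0" by (simp del: power_Suc)
    qed
  next
    assume zero: "\<forall>q\<in>W. \<forall>n\<ge>1. L2_inner torus (\<lambda>x. snd x ^ n * q x) q = 0"
    show "\<exists>M. invariant_subspace M \<and> W = wandering_subspace M"
    proof (rule wandering_subspace_exists[OF assms])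
      fix f g n assume fg: "f \<in> W" "g \<in> W"
      show "L2_inner torus (\<lambda>x. snd x ^ Suc n * f x) g = 0"
      proof (rule L2_polarization[OF assms(1) _ _ fg])
        show "(\<lambda>x. snd x ^ Suc n * h x) \<in> L2 torus" if "h \<in> W" for h
          using closed_subspaceD(1)[OF assms(1) that] by (rule L2_mult_snd_power)
        show "L2_inner torus (\<lambda>x. snd x ^ Suc n * h x) h = 0" if "h \<in> W" for h
          using zero that by (simp del: power_Suc)
      qed
    qed
  qed
  also have "\<dots> \<longleftrightarrow> (\<forall>q\<in>W. \<exists>c::real. AE w in circle.
       (\<lambda>j. (cmod ((backward_shift ^^ j) (slice_zero q) w))\<^sup>2) sums c)"
    using constant_energy_iff assms(2) by (intro ball_cong) auto
  finally show ?thesis .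
qed

end
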